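(* There exists a randomized data structure that takes as input positive integers $c,n,\kappa$ and initializes a function $\Gamma\colon(\{0,1\}^n)^c\to(\{0,1\}^{n+\kappa+1})^{4c}$. In the word RAM model with word size $w$ the data structure satisfies: (i) the space usage is $O(2^{2n+\kappa}c^3(n+\kappa)/w)$ words; (ii) the evaluation time of $\Gamma$ is $O(c^2+c^3(n+\kappa)/w)$; (iii) $\Gamma$ is $2^{\kappa}$-unique with probability at least $1-2^{-cn}$.
   Context: A function $\Gamma\colon(\{0,1\}^n)^c\to(\{0,1\}^m)^d$ defines a $d$-regular bipartite graph between inputs and the output set $\{1,\dots,d\}\times\{0,1\}^m$, with $x$ adjacent to $(i,\Gamma(x)_i)$ for $i=1,\dots,d$; for a set $S$ of inputs, $\Gamma(S)=\{(i,\Gamma(x)_i):x\in S, 1\le i\le d\}$. $\Gamma$ is $k$-unique if for every $S\subseteq(\{0,1\}^n)^c$ with $|S|\le k$ there exists $x\in S$ with $|\Gamma(\{x\})\setminus\Gamma(S\setminus\{x\})|>0$. Model: word RAM with word size $w$ (assumed large enough to address the space used), augmented with an instruction producing a uniformly random integer in $[r]$, $r\le 2^w$, in constant time.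
   Formalization: In the definition of k-unique the set S is taken nonempty (for S empty the literal condition fails for every Γ), and the space bound is read as O(⌈2^{2n+κ}c^3(n+κ)/w⌉) words, i.e. rounded up to a whole number of words. *)

theory Defs
  imports "HOL-Probability.Probability"
begin

section \<open>Unique-neighbour functions\<close>

text \<open>Bit strings are Boolean lists, and \<open>vectors c n\<close> is \<open>({0,1}^n)^c\<close>.\<close>

definition vectors :: "nat \<Rightarrow> nat \<Rightarrow> bool list list set" where
  "vectors c n = {x. length x = c \<and> (\<forall>b\<in>set x. length b = n)}"

definition neighbours :: "nat \<Rightarrow> (bool list list \<Rightarrow> bool list list) \<Rightarrow> bool list list set \<Rightarrow> (nat \<times> bool list) set" where
  "neighbours d \<Gamma> S = {(i, \<Gamma> x ! (i - 1)) | i x. x \<in> S \<and> i \<in> {1..d}}"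

text \<open>The empty set has to be excluded: it contains no \<open>x\<close> at all.\<close>

definition k_unique :: "nat \<Rightarrow> nat \<Rightarrow> nat \<Rightarrow> nat \<Rightarrow> (bool list list \<Rightarrow> bool list list) \<Rightarrow> bool" where
  "k_unique c n d k \<Gamma> \<longleftrightarrow>
     (\<forall>S \<subseteq> vectors c n. S \<noteq> {} \<and> card S \<le> k \<longrightarrow>
        (\<exists>x\<in>S. card (neighbours d \<Gamma> {x} - neighbours d \<Gamma> (S - {x})) > 0))"


section \<open>The randomized word RAM\<close>

text \<open>
  Words are natural numbers below \<open>2 ^ w\<close>. A program is a list of instructions over registers
  (finitely many for each program), a memory of \<open>sp\<close> words with indirect addressing, a read-only
  input array and a write-only output array; every instruction takes one time step.
  The word size is not a parameter of the program, which can query it with \<open>Word_Size\<close>.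
\<close>

datatype binop = Add | Sub | Mul | Div | Mod | And | Or | Xor | Shl | Shr | Less | Eq

datatype instr =
    Const nat nat           \<comment> \<open>\<open>R[r] := v\<close>\<close>
  | Word_Size nat           \<comment> \<open>\<open>R[r] := w\<close>\<close>
  | Binop binop nat nat nat \<comment> \<open>\<open>R[r] := R[a] op R[b]\<close>\<close>
  | Load nat nat            \<comment> \<open>\<open>R[r] := M[R[a]]\<close>\<close>
  | Store nat nat           \<comment> \<open>\<open>M[R[a]] := R[b]\<close>\<close>
  | Input nat nat           \<comment> \<open>\<open>R[r] := In[R[a]]\<close>\<close>
  | Output nat nat          \<comment> \<open>\<open>Out[R[a]] := R[b]\<close>\<close>
  | Random nat nat          \<comment> \<open>\<open>R[r] :=\<close> uniformly random element of \<open>{0,\<dots>,R[a]-1}\<close>\<close>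
  | Jump nat
  | Jump_Zero nat nat       \<comment> \<open>jump to \<open>l\<close> if \<open>R[a] = 0\<close>\<close>

type_synonym program = "instr list"

record state =
  pc :: nat
  regs :: "nat \<Rightarrow> nat"
  mem :: "nat \<Rightarrow> nat"
  outp :: "nat \<Rightarrow> nat"

fun binop_val :: "nat \<Rightarrow> binop \<Rightarrow> nat \<Rightarrow> nat \<Rightarrow> nat" where
  "binop_val w Add a b = (a + b) mod 2 ^ w"
| "binop_val w Sub a b = (2 ^ w + a - b) mod 2 ^ w"
| "binop_val w Mul a b = (a * b) mod 2 ^ w"
| "binop_val w Div a b = a div b"
| "binop_val w Mod a b = a mod b"
| "binop_val w And a b = semiring_bit_operations_class.and a b"
| "binop_val w Or a b = semiring_bit_operations_class.or a b"
| "binop_val w Xor a b = semiring_bit_operations_class.xor a b"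
| "binop_val w Shl a b = (a * 2 ^ b) mod 2 ^ w"
| "binop_val w Shr a b = a div 2 ^ b"
| "binop_val w Less a b = of_bool (a < b)"
| "binop_val w Eq a b = of_bool (a = b)"

definition set_reg :: "nat \<Rightarrow> nat \<Rightarrow> nat \<Rightarrow> state \<Rightarrow> state" where
  "set_reg w r v s = s\<lparr>pc := Suc (pc s), regs := (regs s)(r := v mod 2 ^ w)\<rparr>"

text \<open>
  An access outside the memory or the input blocks the machine: it stays in the same state and
  never halts. In \<open>Random\<close>, the range \<open>2 ^ w\<close> does not fit into a word and is encoded by 0.
\<close>

fun exec :: "nat \<Rightarrow> nat \<Rightarrow> nat list \<Rightarrow> instr \<Rightarrow> state \<Rightarrow> state pmf" where
  "exec w sp inp (Const r v) s = return_pmf (set_reg w r v s)"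
| "exec w sp inp (Word_Size r) s = return_pmf (set_reg w r w s)"
| "exec w sp inp (Binop f r a b) s =
     return_pmf (set_reg w r (binop_val w f (regs s a) (regs s b)) s)"
| "exec w sp inp (Load r a) s = return_pmf
     (if regs s a < sp then set_reg w r (mem s (regs s a)) s else s)"
| "exec w sp inp (Store a b) s = return_pmf
     (if regs s a < sp then s\<lparr>pc := Suc (pc s), mem := (mem s)(regs s a := regs s b)\<rparr> else s)"
| "exec w sp inp (Input r a) s = return_pmf
     (if regs s a < length inp then set_reg w r (inp ! regs s a) s else s)"
| "exec w sp inp (Output a b) s = return_pmf
     (s\<lparr>pc := Suc (pc s), outp := (outp s)(regs s a := regs s b)\<rparr>)"
| "exec w sp inp (Random r a) s = map_pmf (\<lambda>v. set_reg w r v s)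
     (pmf_of_set {..<if regs s a = 0 then 2 ^ w else regs s a})"
| "exec w sp inp (Jump l) s = return_pmf (s\<lparr>pc := l\<rparr>)"
| "exec w sp inp (Jump_Zero a l) s = return_pmf
     (s\<lparr>pc := if regs s a = 0 then l else Suc (pc s)\<rparr>)"

definition halted :: "program \<Rightarrow> state \<Rightarrow> bool" where
  "halted p s \<longleftrightarrow> length p \<le> pc s"

definition step :: "nat \<Rightarrow> nat \<Rightarrow> program \<Rightarrow> nat list \<Rightarrow> state \<Rightarrow> state pmf" where
  "step w sp p inp s = (if halted p s then return_pmf s else exec w sp inp (p ! pc s) s)"

fun run :: "nat \<Rightarrow> nat \<Rightarrow> program \<Rightarrow> nat list \<Rightarrow> nat \<Rightarrow> state \<Rightarrow> state pmf" where
  "run w sp p inp 0 s = return_pmf s"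
| "run w sp p inp (Suc t) s = bind_pmf (step w sp p inp s) (run w sp p inp t)"

text \<open>Only the memory survives from one program run to the next.\<close>

definition start :: "(nat \<Rightarrow> nat) \<Rightarrow> state" where
  "start M = \<lparr>pc = 0, regs = (\<lambda>_. 0), mem = M, outp = (\<lambda>_. 0)\<rparr>"


section \<open>Data structures representing a function\<close>

definition bits_to_nat :: "bool list \<Rightarrow> nat" where
  "bits_to_nat b = horner_sum of_bool 2 b"

text \<open>
  \<open>evaluates w sp query c n d \<tau> \<Gamma> M\<close>: starting from memory contents \<open>M\<close>, every sequence of
  evaluations of \<open>\<Gamma>\<close> by the program \<open>query\<close> is answered correctly, each in time at most \<open>\<tau>\<close>.
  An evaluation may modify the memory, hence the coinduction. Arguments and results are passed
  with one word per component.
\<close>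

coinductive evaluates ::
  "nat \<Rightarrow> nat \<Rightarrow> program \<Rightarrow> nat \<Rightarrow> nat \<Rightarrow> nat \<Rightarrow> real \<Rightarrow> (bool list list \<Rightarrow> bool list list) \<Rightarrow> (nat \<Rightarrow> nat) \<Rightarrow> bool"
  for w sp query c n d \<tau> \<Gamma> where
  "(\<forall>x\<in>vectors c n. \<exists>t. real t \<le> \<tau> \<and>
      (\<forall>s\<in>set_pmf (run w sp query (map bits_to_nat x) t (start M)).
         halted query s \<and>
         (\<forall>i<d. outp s i = bits_to_nat (\<Gamma> x ! i)) \<and>
         evaluates w sp query c n d \<tau> \<Gamma> (mem s)))
   \<Longrightarrow> evaluates w sp query c n d \<tau> \<Gamma> M"

end

theory Submission
  imports Defs
begin

text \<open>
  The function is built from \<open>\<Gamma>\<^sub>0 = 0\<close> by \<open>\<Gamma>\<^sub>i\<^sub>+\<^sub>1(x, y) = \<Oplus>\<^sub>k T\<^sub>i[k, x, \<Gamma>\<^sub>i(y)\<^sub>k]\<close> with tables \<open>T\<^sub>i\<close> of random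
  \<open>d\<close>-tuples, \<open>d = 4 c\<close>. If \<open>\<Gamma>\<^sub>i\<close> is unique, then every set of at most \<open>2\<^sup>\<kappa>\<close> keys can be peeled: some
  key owns a table cell that no other key of the set reads. Hence \<open>\<Gamma>\<^sub>i\<^sub>+\<^sub>1\<close> is uniform on each such
  set \<open>S\<close>, and \<open>S\<close> violates uniqueness only if each of \<open>d\<close> independent random functions
  \<open>S \<rightarrow> {0,1}\<^sup>b\<close>, \<open>b = n + \<kappa> + 1\<close>, takes no value exactly once. For \<open>|S| = s\<close> this has probability at
  most \<open>2 ^ (- 2 c n s)\<close>; a union bound over the sets and over the \<open>c\<close> levels leaves \<open>2 ^ (- c n)\<close>.
  In the time bound, one factor \<open>c\<close> is saved by packing the \<open>b\<close>-bit components of a table entry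
  into words, whose exclusive or is taken in parallel.
\<close>

unbundle bit_operations_syntax

section \<open>Peeling\<close>

text \<open>Probabilities are cardinalities of sets of table contents, and uniformity on
  \<open>S\<close> is a comparison of fibres: if the level below is unique, xoring an offset onto
  one level of tables carries the contents that produce one family of values on \<open>S\<close>
  into those that produce another. The offset has to vary with the tables, since the values of the
  level below decide which cells are read. The map is still injective, because the offset is a
  function of those values alone and leaves them unchanged.

  The constants come from the count of bad maps. A map on \<open>s\<close> keys that takes no value
  exactly once has at most \<open>s / 2\<close> values; such maps have probability at most
  \<open>(2 * s / 2 ^ b) ^ (s / 2)\<close>. By the choice of \<open>b\<close> the base is at most
  \<open>2 ^ (- n)\<close>; then \<open>d = 4 * c\<close> components make the exponent twice what
  the number of \<open>s\<close>-sets requires, and the excess pays for the sums over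
  \<open>s\<close> and over the levels.

  Packing matters for the probability only through one fact: distinct fields occupy disjoint bits,
  so xoring words of memory realises every offset.\<close>

fun xor_sum :: "(nat \<Rightarrow> nat) \<Rightarrow> nat \<Rightarrow> nat" where
  "xor_sum f 0 = 0"
| "xor_sum f (Suc k) = xor_sum f k XOR f k"

lemma xor_sum_cong: "(\<And>k. k < d \<Longrightarrow> f k = g k) \<Longrightarrow> xor_sum f d = xor_sum g d"
  by (induction d) auto

lemma xor_sum_xor: "xor_sum (\<lambda>k. f k XOR g k) d = xor_sum f d XOR xor_sum g d"
  by (induction d) (auto simp: ac_simps)

lemma xor_less_power: "x < 2 ^ b \<Longrightarrow> y < 2 ^ b \<Longrightarrow> x XOR y < (2 ^ b :: nat)"
  by (metis take_bit_nat_eq_self_iff take_bit_xor)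

lemma xor_sum_less: "(\<And>k. k < d \<Longrightarrow> f k < 2 ^ b) \<Longrightarrow> xor_sum f d < 2 ^ b"
  by (induction d) (auto intro: xor_less_power)

text \<open>Isolating one summand lets an equation for the whole sum be solved for the value of a
  single cell.\<close>

lemma xor_sum_update:
  "k < d \<Longrightarrow> xor_sum (f(k := v)) d = xor_sum (f(k := 0)) d XOR v"
proof (induction d)
  case (Suc d)
  show ?case
  proof (cases "k = d")
    case True
    have "xor_sum (f(d := v)) d = xor_sum (f(d := 0)) d"
      by (rule xor_sum_cong) auto
    with True show ?thesis by (simp del: fun_upd_apply) (simp add: fun_upd_def)
  next
    case False
    with Suc show ?thesis by (auto simp: ac_simps)
  qed
qed simp

text \<open>The arguments of \<open>t\<close> are the level, the summand, the first coordinate, the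
  value read from the level below and the component of the entry. The level is the length of the
  tail, so the last coordinate of a key is consumed at level 0, and a key of length \<open>i\<close>
  reads only levels below \<open>i\<close>.\<close>

fun tower :: "nat \<Rightarrow> (nat \<Rightarrow> nat \<Rightarrow> nat \<Rightarrow> nat \<Rightarrow> nat \<Rightarrow> nat) \<Rightarrow> nat list \<Rightarrow> nat \<Rightarrow> nat" where
  "tower d t [] j = 0"
| "tower d t (x # xs) j = xor_sum (\<lambda>k. t (length xs) k x (tower d t xs k) j) d"

definition words :: "nat \<Rightarrow> nat \<Rightarrow> nat list set" where
  "words n i = {xs. length xs = i \<and> set xs \<subseteq> {..<2 ^ n}}"

text \<open>Component \<open>j\<close> together with its value is a neighbour in the bipartite
  graph, so some key owns a neighbour; \<open>unique_upto\<close> is then \<open>k_unique\<close>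
  for numeric keys and values.\<close>

definition uniquely_coloured :: "nat \<Rightarrow> (nat list \<Rightarrow> nat \<Rightarrow> nat) \<Rightarrow> nat list set \<Rightarrow> bool" where
  "uniquely_coloured d \<gamma> S \<longleftrightarrow> (\<exists>x\<in>S. \<exists>j<d. \<forall>y\<in>S - {x}. \<gamma> y j \<noteq> \<gamma> x j)"

definition unique_upto :: "nat \<Rightarrow> nat \<Rightarrow> nat \<Rightarrow> nat \<Rightarrow> (nat list \<Rightarrow> nat \<Rightarrow> nat) \<Rightarrow> bool" where
  "unique_upto n i d k \<gamma> \<longleftrightarrow>
     (\<forall>S \<subseteq> words n i. S \<noteq> {} \<and> card S \<le> k \<longrightarrow> uniquely_coloured d \<gamma> S)"

lemma finite_words: "finite (words n i)"
  unfolding words_def using finite_lists_length_eq[of "{..<2 ^ n :: nat}" i] by (simp add: conj_commute)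

lemma card_words: "card (words n i) = 2 ^ (n * i)"
  unfolding words_def using card_lists_length_eq[of "{..<2 ^ n :: nat}" i]
  by (simp add: conj_commute power_mult)

text \<open>
  Peeling: a set of keys whose tail sets are uniquely coloured can be emptied one key at a time,
  each key owning a table cell that no remaining key reads.
\<close>

lemma peeling_offset:
  assumes "unique_upto n i d K \<gamma>" "S \<subseteq> words n (Suc i)" "card S \<le> K"
    and g: "\<And>x j. g x j < 2 ^ b"
  shows "\<exists>D. (\<forall>k x v j. D k x v j < (2 ^ b :: nat)) \<and>
           (\<forall>x xs. x # xs \<in> S \<longrightarrow> (\<forall>j. xor_sum (\<lambda>k. D k x (\<gamma> xs k) j) d = g (x # xs) j))"
  using assms(2,3)
proof (induction "card S" arbitrary: S)
  case 0
  have "finite S" using 0 finite_words finite_subset by blast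
  with 0 have "S = {}" by simp
  then show ?case by (intro exI[of _ "\<lambda>_ _ _ _. 0"]) auto
next
  case (Suc s)
  have fin: "finite S" using Suc.prems(1) finite_words finite_subset by blast
  have "S \<noteq> {}" using Suc.hyps(2) by auto
  then obtain y where "y \<in> S" by blast
  with Suc.prems(1) have "y \<in> words n (Suc i)" by blast
  then obtain x ys where y: "y = x # ys" unfolding words_def by (cases y) auto
  \<comment> \<open>Cells for different first coordinates are distinct, so a private cell of a key
    only has to be separated from the keys that share its first coordinate \<open>x\<close>. Hence
    uniqueness of \<open>\<gamma>\<close> is needed on tails only.\<close>
  define S' where "S' = {xs. x # xs \<in> S}"
  have sub: "S' \<subseteq> words n i" using Suc.prems(1) unfolding S'_def words_def by fastforce
  have "card S' \<le> card S"
  proof -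
    have "(\<lambda>xs. x # xs) ` S' \<subseteq> S" by (auto simp: S'_def)
    then have "card ((\<lambda>xs. x # xs) ` S') \<le> card S" using fin card_mono by blast
    then show ?thesis by (simp add: card_image)
  qed
  moreover have "S' \<noteq> {}" using \<open>y \<in> S\<close> y by (auto simp: S'_def)
  ultimately have "uniquely_coloured d \<gamma> S'"
    using assms(1) sub Suc.prems(2) unfolding unique_upto_def by auto
  then obtain xs k where xs: "x # xs \<in> S" "k < d"
    and sep: "\<And>zs. x # zs \<in> S \<Longrightarrow> zs \<noteq> xs \<Longrightarrow> \<gamma> zs k \<noteq> \<gamma> xs k"
    unfolding uniquely_coloured_def S'_def by auto
  have "s = card (S - {x # xs})" using Suc.hyps(2) xs(1) fin by simp
  moreover have "S - {x # xs} \<subseteq> words n (Suc i)" using Suc.prems(1) by blast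
  moreover have "card (S - {x # xs}) \<le> K" using Suc.prems(2) fin xs(1) by simp
  ultimately have "\<exists>D. (\<forall>k x v j. D k x v j < (2 ^ b :: nat)) \<and>
           (\<forall>z zs. z # zs \<in> S - {x # xs} \<longrightarrow>
              (\<forall>j. xor_sum (\<lambda>k. D k z (\<gamma> zs k) j) d = g (z # zs) j))"
    by (rule Suc.hyps(1))
  then obtain D where D: "\<And>k x v j. D k x v j < 2 ^ b"
    and Dg: "\<And>z zs j. z # zs \<in> S \<Longrightarrow> z # zs \<noteq> x # xs \<Longrightarrow>
       xor_sum (\<lambda>k. D k z (\<gamma> zs k) j) d = g (z # zs) j"
    by blast
  \<comment> \<open>\<open>u\<close> is the value that the private cell must take to bring the sum
    for \<open>x # xs\<close> to \<open>g\<close>. The keys covered by the induction hypothesis do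
    not read that cell, so their equations persist.\<close>
  define u where "u = (\<lambda>j. xor_sum ((\<lambda>k. D k x (\<gamma> xs k) j)(k := 0)) d XOR g (x # xs) j)"
  define D' where "D' = (\<lambda>k' z v j. if k' = k \<and> z = x \<and> v = \<gamma> xs k then u j else D k' z v j)"
  have u: "u j < 2 ^ b" for j
    unfolding u_def by (intro xor_less_power xor_sum_less g) (auto simp: D)
  have "xor_sum (\<lambda>k'. D' k' z (\<gamma> zs k') j) d = g (z # zs) j" if z: "z # zs \<in> S" for z zs j
  proof (cases "z # zs = x # xs")
    case True
    have "xor_sum (\<lambda>k'. D' k' x (\<gamma> xs k') j) d = xor_sum ((\<lambda>k'. D k' x (\<gamma> xs k') j)(k := u j)) d"
      by (rule xor_sum_cong) (auto simp: D'_def)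
    also have "\<dots> = g (x # xs) j"
      by (subst xor_sum_update[OF xs(2)]) (simp add: u_def xor.assoc[symmetric])
    finally show ?thesis using True by simp
  next
    case False
    have "xor_sum (\<lambda>k'. D' k' z (\<gamma> zs k') j) d = xor_sum (\<lambda>k'. D k' z (\<gamma> zs k') j) d"
      using sep z False by (intro xor_sum_cong) (auto simp: D'_def)
    with Dg[OF z False] show ?thesis by simp
  qed
  moreover have "D' k' z v j < 2 ^ b" for k' z v j by (simp add: D'_def u D)
  ultimately show ?case by blast
qed

section \<open>Counting maps that take no value exactly once\<close>

definition no_singleton_maps :: "'a set \<Rightarrow> nat \<Rightarrow> ('a \<Rightarrow> nat) set" where
  "no_singleton_maps S m = {f \<in> S \<rightarrow>\<^sub>E {..<m}. \<forall>x\<in>S. \<exists>y\<in>S - {x}. f y = f x}"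

text \<open>Each value is taken at least twice, so the image has at most \<open>card S div 2\<close>
  elements and can be enlarged to a set \<open>B\<close> of exactly that size. The bound counts the
  choices of \<open>B\<close> and the maps into it.\<close>

lemma card_no_singleton_maps:
  assumes "finite S" "card S div 2 \<le> m"
  shows "card (no_singleton_maps S m) \<le> (m choose (card S div 2)) * (card S div 2) ^ card S"
proof -
  let ?h = "card S div 2"
  let ?B = "{B. B \<subseteq> {..<m} \<and> card B = ?h}"
  have "no_singleton_maps S m \<subseteq> (\<Union>B\<in>?B. S \<rightarrow>\<^sub>E B)"
  proof
    fix f assume "f \<in> no_singleton_maps S m"
    then have f: "f \<in> S \<rightarrow>\<^sub>E {..<m}" and ns: "\<And>x. x \<in> S \<Longrightarrow> \<exists>y\<in>S - {x}. f y = f x"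
      by (auto simp: no_singleton_maps_def)
    have "2 \<le> card {x \<in> S. f x = y}" if "y \<in> f ` S" for y
    proof -
      from that obtain x where x: "x \<in> S" "y = f x" by blast
      with ns obtain x' where "x' \<in> S - {x}" "f x' = f x" by blast
      with x have "{x, x'} \<subseteq> {x \<in> S. f x = y}" "card {x, x'} = 2" by auto
      then show ?thesis using card_mono[of "{x \<in> S. f x = y}" "{x, x'}"] assms(1) by simp
    qed
    then have "(\<Sum>y\<in>f ` S. 2) \<le> (\<Sum>y\<in>f ` S. card {x \<in> S. f x = y})"
      by (intro sum_mono)
    also have "\<dots> = card S"
      using sum.image_gen[OF assms(1), of "\<lambda>_. 1 :: nat" f] by simp
    finally have "card (f ` S) \<le> ?h" by simp
    moreover have "f ` S \<subseteq> {..<m}" using f by auto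
    ultimately obtain B where "f ` S \<subseteq> B" "B \<subseteq> {..<m}" "card B = ?h"
      using assms(2) exists_subset_between[of "f ` S" ?h "{..<m}"] by auto
    then show "f \<in> (\<Union>B\<in>?B. S \<rightarrow>\<^sub>E B)" using f by (auto simp: PiE_def Pi_def)
  qed
  moreover have finB: "finite ?B" by simp
  moreover have "finite (\<Union>B\<in>?B. S \<rightarrow>\<^sub>E B)"
    using assms(1) by (intro finite_UN_I finB finite_PiE) (auto intro: finite_subset)
  ultimately have "card (no_singleton_maps S m) \<le> card (\<Union>B\<in>?B. S \<rightarrow>\<^sub>E B)"
    by (intro card_mono)
  also have "\<dots> \<le> (\<Sum>B\<in>?B. card (S \<rightarrow>\<^sub>E B))" by (rule card_UN_le[OF finB])
  also have "\<dots> = (\<Sum>B\<in>?B. ?h ^ card S)"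
    using assms(1) by (intro sum.cong) (auto simp: card_PiE)
  also have "\<dots> = (m choose ?h) * ?h ^ card S"
    using n_subsets[of "{..<m}" ?h] by simp
  finally show ?thesis .
qed

lemma fact_mult_power_le: "(fact h :: nat) * h ^ k \<le> fact (h + k)"
proof (induction k)
  case (Suc k)
  have "(fact h :: nat) * h ^ Suc k = (fact h * h ^ k) * h" by simp
  also have "\<dots> \<le> fact (h + k) * (h + Suc k)" using Suc by (intro mult_mono) auto
  finally show ?case by (simp add: mult.commute)
qed simp

text \<open>A weak form of Stirling's estimate: \<open>fact h * h ^ h \<le> fact (h + h)\<close> is
  compared with the central binomial coefficient, which is at most \<open>4 ^ h\<close>. With
  \<open>h\<close> about half of \<open>card S\<close>, the 4 becomes the factor 2 of the bound
  below.\<close>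

lemma power_self_le_fact: "h ^ h \<le> 4 ^ h * (fact h :: nat)"
proof -
  have "fact h * h ^ h \<le> (fact (h + h) :: nat)" by (rule fact_mult_power_le)
  also have "\<dots> = fact h * (fact h * (h + h choose h))"
    using binomial_fact_lemma[of h "h + h"] by (simp only: mult.assoc) simp
  finally have "h ^ h \<le> fact h * (h + h choose h)"
    by (subst (asm) mult_le_cancel1) simp
  also have "\<dots> \<le> fact h * 2 ^ (h + h)" by (intro mult_left_mono binomial_le_pow2) simp
  also have "(2 :: nat) ^ (h + h) = 4 ^ h" by (simp add: power_mult[symmetric] mult_2[symmetric] power_mult)
  finally show ?thesis by (simp only: mult.commute)
qed

text \<open>In substance the number of these maps is at most \<open>(2 * m * s) ^ (s / 2)\<close>;
  squaring avoids a half-integral exponent. The binomial coefficient is estimated by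
  \<open>m ^ h / fact h\<close>, and \<open>fact h\<close> is traded for
  \<open>h ^ h / 4 ^ h\<close>. The square suffices later because the number of components is
  even.\<close>

lemma card_no_singleton_maps_squared:
  assumes "finite S" "card S \<le> m"
  shows "card (no_singleton_maps S m) ^ 2 \<le> (2 * m * card S) ^ card S"
proof -
  define s where "s = card S"
  define h where "h = s div 2"
  have hm: "h \<le> m" using assms by (simp add: h_def s_def)
  have "fact h * card (no_singleton_maps S m) \<le> fact h * ((m choose h) * h ^ s)"
    using card_no_singleton_maps[of S m] assms hm unfolding h_def s_def by simp
  also have "\<dots> \<le> m ^ h * h ^ s"
    using mult_right_mono[OF binomial_fact_pow[of m h], of "h ^ s"]
    by (simp only: ac_simps zero_le)
  finally have fact_bound: "fact h * card (no_singleton_maps S m) \<le> m ^ h * h ^ s" .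
  have "h ^ h * card (no_singleton_maps S m) \<le> 4 ^ h * fact h * card (no_singleton_maps S m)"
    by (intro mult_right_mono power_self_le_fact) simp
  also have "\<dots> \<le> 4 ^ h * (m ^ h * h ^ s)"
    unfolding mult.assoc by (intro mult_left_mono fact_bound) simp
  also have "\<dots> = h ^ h * ((4 * m) ^ h * h ^ (s - h))"
  proof -
    have "h \<le> s" by (simp add: h_def)
    then have split: "h ^ s = h ^ h * h ^ (s - h)" by (simp flip: power_add)
    show ?thesis unfolding split power_mult_distrib by (simp only: ac_simps)
  qed
  \<comment> \<open>Cancelling \<open>h ^ h\<close> is legitimate also for \<open>h = 0\<close>,
    where it is \<open>0 ^ 0 = 1\<close>.\<close>
  finally have N: "card (no_singleton_maps S m) \<le> (4 * m) ^ h * h ^ (s - h)"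
    unfolding mult_le_cancel1 by (cases "h = 0") (simp_all only: power_0 gr0I simp_thms zero_less_one zero_less_power)
  then have "card (no_singleton_maps S m) ^ 2 \<le> ((4 * m) ^ h * h ^ (s - h)) ^ 2"
    by (rule power_mono) simp
  also have "\<dots> = (4 * m) ^ (2 * h) * h ^ (2 * (s - h))"
    by (simp only: power_mult_distrib power_mult[symmetric] mult.commute[of _ 2])
  also have "\<dots> \<le> (2 * m * s) ^ s"
  proof (cases "even s")
    case True
    then have "s = 2 * h" by (simp add: h_def)
    then have "s - h = h" "2 * m * s = 4 * m * h" by auto
    with \<open>s = 2 * h\<close> show ?thesis by (simp add: power_mult_distrib)
  next
    case False
    then have s: "s = 2 * h + 1" unfolding h_def by presburger
    \<comment> \<open>Here the exponent of \<open>h\<close> is \<open>s + 1\<close>, one too many,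
      and that of \<open>4 * m\<close> is one too few; the surplus \<open>h \<le> m\<close> is
      replaced by the missing factor.\<close>
    have "(4 * m) ^ (2 * h) * h ^ (2 * (s - h)) = (4 * m) ^ (2 * h) * (h * h ^ s)"
      by (simp add: s)
    also have "\<dots> \<le> (4 * m) ^ (2 * h) * ((4 * m) * h ^ s)"
      using hm by (intro mult_le_mono order_refl) simp
    also have "\<dots> = (4 * m * h) ^ s" by (simp add: s power_mult_distrib)
    also have "\<dots> \<le> (2 * m * s) ^ s" by (intro power_mono) (auto simp: s)
    finally show ?thesis .
  qed
  finally show ?thesis by (simp add: s_def)
qed

lemma tower_less:
  assumes "\<And>i k x v j. t i k x v j < 2 ^ b"
  shows "tower d t xs j < 2 ^ b"
  by (cases xs) (auto intro: xor_sum_less assms)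

text \<open>This is what allows the tables of level \<open>length xs\<close> and above to be changed
  without affecting the value at \<open>xs\<close>. The bound on \<open>t\<close> keeps the values
  looked up inside the range where the tables agree.\<close>

lemma tower_cong:
  assumes "\<And>i k x v j. t i k x v j < 2 ^ b"
    and "\<And>i k x v j. i < length xs \<Longrightarrow> k < d \<Longrightarrow> x < 2 ^ n \<Longrightarrow> v < 2 ^ b \<Longrightarrow> j < d \<Longrightarrow>
           t i k x v j = t' i k x v j"
    and "set xs \<subseteq> {..<2 ^ n}" "j < d"
  shows "tower d t xs j = tower d t' xs j"
  using assms(2-4)
proof (induction xs arbitrary: j)
  case (Cons x xs)
  have "t (length xs) k x (tower d t xs k) j = t' (length xs) k x (tower d t' xs k) j" if "k < d" for k
  proof -
    have "tower d t xs k = tower d t' xs k"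
      using Cons.prems that by (intro Cons.IH) auto
    moreover have "tower d t xs k < 2 ^ b" by (rule tower_less) (rule assms(1))
    ultimately show ?thesis
      using Cons.prems(1)[of "length xs" k x "tower d t xs k" j] Cons.prems(2,3) that by auto
  qed
  then show ?case by (auto intro: xor_sum_cong)
qed simp

lemma uniquely_coloured_cong:
  assumes "\<And>x j. x \<in> S \<Longrightarrow> j < d \<Longrightarrow> \<gamma> x j = \<gamma>' x j"
  shows "uniquely_coloured d \<gamma> S = uniquely_coloured d \<gamma>' S"
  unfolding uniquely_coloured_def using assms by (metis DiffD1)

lemma unique_upto_cong:
  assumes "\<And>x j. x \<in> words n i \<Longrightarrow> j < d \<Longrightarrow> \<gamma> x j = \<gamma>' x j"
  shows "unique_upto n i d k \<gamma> = unique_upto n i d k \<gamma>'"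
  unfolding unique_upto_def using assms uniquely_coloured_cong[of _ d \<gamma> \<gamma>'] by (meson subsetD)

text \<open>The subtracted term gives the induction its slack: \<open>2 * q \<le> 1\<close> lets it
  pay for the next summand and still reproduce itself.\<close>

lemma sum_geometric_from_two:
  fixes q :: real
  assumes "0 \<le> q" "q \<le> 1 / 2" "K \<ge> 1"
  shows "(\<Sum>s\<in>{2..K}. q ^ s) \<le> 2 * q ^ 2 - 2 * q ^ (K + 1)"
  using assms(3)
proof (induction K rule: dec_induct)
  case (step K)
  have "q ^ (K + 1) * (2 * q) \<le> q ^ (K + 1) * 1"
    using assms by (intro mult_left_mono) auto
  moreover have "{2..Suc K} = insert (Suc K) {2..K}" using step by auto
  ultimately show ?case using step.IH by (simp add: algebra_simps)
qed (simp add: power2_eq_square)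

section \<open>Failure probability over abstract random tables\<close>

text \<open>The randomness enters as invariance under translation: any offset can be xored onto the
  cells in range by an injection of \<open>\<Omega>\<close> into itself. This separates the
  probability bound from the packing of entries into words.\<close>

locale random_tables =
  fixes \<Omega> :: "'m set" and tab :: "'m \<Rightarrow> nat \<Rightarrow> nat \<Rightarrow> nat \<Rightarrow> nat \<Rightarrow> nat \<Rightarrow> nat"
    and c n \<kappa> b d :: nat
  assumes finite_Omega: "finite \<Omega>"
    and c_pos: "c > 0" and n_pos: "n > 0" and b_eq: "b = n + \<kappa> + 1" and d_eq: "d = 4 * c"
    and tab_less: "tab M i k x v j < 2 ^ b"
    and translation: "(\<And>i k x v j. D i k x v j < 2 ^ b) \<Longrightarrow>
       \<exists>\<phi>. inj_on \<phi> \<Omega> \<and> \<phi> ` \<Omega> \<subseteq> \<Omega> \<and>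
         (\<forall>M\<in>\<Omega>. \<forall>i<c. \<forall>k<d. \<forall>x<2 ^ n. \<forall>v<2 ^ b. \<forall>j<d.
            tab (\<phi> M) i k x v j = tab M i k x v j XOR D i k x v j)"
begin

abbreviation "\<gamma> M \<equiv> tower d (tab M)"

definition unique_at :: "nat \<Rightarrow> 'm set" where
  "unique_at i = {M \<in> \<Omega>. unique_upto n i d (2 ^ \<kappa>) (\<gamma> M)}"

text \<open>The restrictions make the possible values a finite product set, over which contents can
  be counted.\<close>

definition vals :: "nat list set \<Rightarrow> 'm \<Rightarrow> nat \<Rightarrow> nat list \<Rightarrow> nat" where
  "vals S M = (\<lambda>j\<in>{..<d}. \<lambda>x\<in>S. \<gamma> M x j)"

lemma gamma_less: "\<gamma> M xs j < 2 ^ b"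
  by (rule tower_less) (rule tab_less)

lemma finite_unique_at: "finite (unique_at i)"
  using finite_Omega by (simp add: unique_at_def)

lemma vals_mem: "vals S M \<in> {..<d} \<rightarrow>\<^sub>E (S \<rightarrow>\<^sub>E {..<2 ^ b})"
  by (auto simp: vals_def gamma_less)

text \<open>By exchanging \<open>f\<close> and \<open>f'\<close>, all these fibres have the same
  size, which is uniformity on \<open>S\<close> in counted form. Peeling gives an offset that turns
  \<open>f\<close> into \<open>f'\<close>, and xoring it onto the tables of level \<open>i\<close>
  maps one fibre injectively into the other.\<close>

lemma card_vals_le:
  assumes i: "i < c" and S: "S \<subseteq> words n (Suc i)" "card S \<le> 2 ^ \<kappa>"
    and f: "f \<in> {..<d} \<rightarrow>\<^sub>E (S \<rightarrow>\<^sub>E {..<2 ^ b})"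
    and f': "f' \<in> {..<d} \<rightarrow>\<^sub>E (S \<rightarrow>\<^sub>E {..<2 ^ b})"
  shows "card {M \<in> unique_at i. vals S M = f} \<le> card {M \<in> unique_at i. vals S M = f'}"
proof -
  define g where "g x j = (if x \<in> S \<and> j < d then f j x XOR f' j x else 0)" for x j
  have gless: "g x j < 2 ^ b" for x j
  proof (cases "x \<in> S \<and> j < d")
    case True
    then have "f j x \<in> {..<2 ^ b}" "f' j x \<in> {..<2 ^ b}" using f f' by (auto simp: PiE_iff)
    with True show ?thesis by (auto simp: g_def intro: xor_less_power)
  qed (auto simp: g_def)
  \<comment> \<open>All that the offset may depend on. Values at keys of length \<open>i\<close>
    come from levels below \<open>i\<close>, which the translation leaves alone.\<close>
  define lower where "lower M = (\<lambda>xs\<in>words n i. \<lambda>j\<in>{..<d}. \<gamma> M xs j)" for M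
  define good where "good l \<phi> \<longleftrightarrow> inj_on \<phi> \<Omega> \<and> \<phi> ` \<Omega> \<subseteq> \<Omega> \<and> (\<exists>D.
      (\<forall>x xs. x # xs \<in> S \<longrightarrow> (\<forall>j. xor_sum (\<lambda>k. D k x (l xs k) j) d = g (x # xs) j)) \<and>
      (\<forall>M\<in>\<Omega>. \<forall>i'<c. \<forall>k<d. \<forall>x<2 ^ n. \<forall>v<2 ^ b. \<forall>j<d. tab (\<phi> M) i' k x v j =
         (if i' = i then tab M i k x v j XOR D k x v j else tab M i' k x v j)))"
    for l \<phi>
  \<comment> \<open>The translation is chosen once for each function \<open>l\<close>, not for each
    \<open>M\<close>: contents with the same lower values must be moved by the same
    injection.\<close>
  define \<Phi> where "\<Phi> l = (SOME \<phi>. good l \<phi>)" for l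
  define \<psi> where "\<psi> M = \<Phi> (lower M) M" for M
  have good: "good (lower M) (\<Phi> (lower M))" if M: "M \<in> unique_at i" for M
  proof -
    have "unique_upto n i d (2 ^ \<kappa>) (lower M)"
      using M unique_upto_cong[of n i d "\<gamma> M" "lower M"] by (auto simp: unique_at_def lower_def)
    from peeling_offset[where g = g, OF this S gless] obtain D where D: "\<forall>k x v j. D k x v j < 2 ^ b"
      "\<forall>x xs. x # xs \<in> S \<longrightarrow> (\<forall>j. xor_sum (\<lambda>k. D k x (lower M xs k) j) d = g (x # xs) j)"
      by (elim exE conjE)
    have "(if i' = i then D k x v j else 0) < 2 ^ b" for i' k x v j using D(1) by simp
    from translation[of "\<lambda>i' k x v j. if i' = i then D k x v j else 0", OF this]
    obtain \<phi> where "inj_on \<phi> \<Omega>" "\<phi> ` \<Omega> \<subseteq> \<Omega>"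
      "\<forall>M\<in>\<Omega>. \<forall>i'<c. \<forall>k<d. \<forall>x<2 ^ n. \<forall>v<2 ^ b. \<forall>j<d. tab (\<phi> M) i' k x v j =
         tab M i' k x v j XOR (if i' = i then D k x v j else 0)"
      by (elim exE conjE)
    with D have "good (lower M) \<phi>"
      unfolding good_def by (intro conjI exI[of _ D]) auto
    then show ?thesis unfolding \<Phi>_def by (rule someI[of "good (lower M)"])
  qed
  have in_Omega: "\<psi> M \<in> \<Omega>" if M: "M \<in> unique_at i" for M
    using good[OF M] M by (auto simp: good_def \<psi>_def unique_at_def)
  have same: "\<gamma> (\<psi> M) xs j = \<gamma> M xs j"
    if M: "M \<in> unique_at i" and xs: "xs \<in> words n i" and j: "j < d" for M xs j
  proof (rule tower_cong[where b = b and n = n])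
    show "tab (\<psi> M) i' k x v j = tab M i' k x v j"
      if "i' < length xs" "k < d" "x < 2 ^ n" "v < 2 ^ b" "j < d" for i' k x v j
      using good[OF M] M xs i that by (auto simp: good_def \<psi>_def unique_at_def words_def)
  qed (use xs j in \<open>auto simp: tab_less words_def\<close>)
  have lower: "lower (\<psi> M) = lower M" if M: "M \<in> unique_at i" for M
    using same[OF M] by (auto simp: lower_def restrict_def fun_eq_iff)
  have unique: "\<psi> M \<in> unique_at i" if M: "M \<in> unique_at i" for M
    using M in_Omega[OF M] unique_upto_cong[of n i d "\<gamma> (\<psi> M)" "\<gamma> M"] same[OF M]
    by (auto simp: unique_at_def)
  have moved: "vals S (\<psi> M) = f'" if M: "M \<in> unique_at i" and v: "vals S M = f" for M
  proof -
    have "\<gamma> (\<psi> M) y j = f' j y" if y: "y \<in> S" and j: "j < d" for y j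
    proof -
      obtain x xs where yx: "y = x # xs" "x < 2 ^ n" "xs \<in> words n i"
        using y S unfolding words_def by (cases y) fastforce+
      then have len: "length xs = i" by (simp add: words_def)
      from good[OF M, unfolded good_def] obtain D where
        D': "\<forall>x xs. x # xs \<in> S \<longrightarrow> (\<forall>j. xor_sum (\<lambda>k. D k x (lower M xs k) j) d = g (x # xs) j)"
        and \<phi>': "\<forall>N\<in>\<Omega>. \<forall>i'<c. \<forall>k<d. \<forall>x<2 ^ n. \<forall>v<2 ^ b. \<forall>j<d. tab (\<Phi> (lower M) N) i' k x v j =
           (if i' = i then tab N i k x v j XOR D k x v j else tab N i' k x v j)"
        by (elim exE conjE)
      have D: "xor_sum (\<lambda>k. D k x (lower M xs k) j) d = g (x # xs) j" using D' y yx by blast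
      have \<phi>: "tab (\<psi> M) i k x v j = tab M i k x v j XOR D k x v j" if "k < d" "v < 2 ^ b" for k v
        using \<phi>' M i yx(2) j that by (simp add: \<psi>_def unique_at_def)
      have "\<gamma> (\<psi> M) y j = xor_sum (\<lambda>k. tab (\<psi> M) i k x (\<gamma> (\<psi> M) xs k) j) d"
        by (simp add: yx len)
      also have "\<dots> = xor_sum (\<lambda>k. tab M i k x (\<gamma> M xs k) j XOR D k x (lower M xs k) j) d"
        using same[OF M yx(3)] yx(3) by (intro xor_sum_cong) (auto simp: \<phi> gamma_less lower_def)
      also have "\<dots> = \<gamma> M y j XOR g y j"
        by (simp add: xor_sum_xor D yx len)
      also have "\<gamma> M y j = f j y" using y j v by (auto simp: vals_def)
      also have "f j y XOR g y j = f' j y" using y j by (simp add: g_def xor.assoc[symmetric])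
      finally show ?thesis .
    qed
    then show ?thesis using f' by (auto simp: vals_def fun_eq_iff restrict_def PiE_iff extensional_def)
  qed
  \<comment> \<open>The image reveals \<open>lower\<close>, hence which of the injections
    \<open>\<Phi>\<close> was applied.\<close>
  have "inj_on \<psi> (unique_at i)"
  proof (rule inj_onI)
    fix M M' assume M: "M \<in> unique_at i" "M' \<in> unique_at i" and eq: "\<psi> M = \<psi> M'"
    then have l: "lower M = lower M'" using lower by metis
    have "inj_on (\<Phi> (lower M)) \<Omega>" using good[OF M(1)] by (simp add: good_def)
    then show "M = M'" using eq M unfolding \<psi>_def l unique_at_def by (auto dest: inj_onD)
  qed
  then have "inj_on \<psi> {M \<in> unique_at i. vals S M = f}" by (rule inj_on_subset) auto
  moreover have "\<psi> ` {M \<in> unique_at i. vals S M = f} \<subseteq> {M \<in> unique_at i. vals S M = f'}"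
    using unique moved by auto
  ultimately show ?thesis using finite_unique_at by (auto intro: card_inj_on_le)
qed

text \<open>Equal fibres let \<open>vals S\<close> take each value in \<open>?V\<close> for at most
  a fraction \<open>1 / card ?V\<close> of the contents. Failure forces all
  \<open>d = 2 * (2 * c)\<close> components into \<open>no_singleton_maps\<close>, a fraction of at
  most \<open>(2 * s / 2 ^ b) ^ (2 * c * s)\<close> of \<open>?V\<close>. Since
  \<open>2 * s \<le> 2 ^ (\<kappa> + 1)\<close> and \<open>b = n + \<kappa> + 1\<close>, the base is
  at most \<open>2 ^ (- n)\<close>.\<close>

lemma card_not_coloured:
  assumes i: "i < c" and S: "S \<subseteq> words n (Suc i)" "card S \<le> 2 ^ \<kappa>" and ne: "S \<noteq> {}"
  shows "card {M \<in> unique_at i. \<not> uniquely_coloured d (\<gamma> M) S} * 2 ^ (2 * c * n * card S) \<le> card \<Omega>"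
proof -
  let ?V = "{..<d} \<rightarrow>\<^sub>E (S \<rightarrow>\<^sub>E {..<2 ^ b :: nat})"
  let ?B = "{..<d} \<rightarrow>\<^sub>E no_singleton_maps S (2 ^ b)"
  let ?E = "{M \<in> unique_at i. \<not> uniquely_coloured d (\<gamma> M) S}"
  define s where "s = card S"
  have finS: "finite S" using S finite_words finite_subset by blast
  have spos: "s > 0" using ne finS by (auto simp: s_def card_gt_0_iff)
  have finV: "finite ?V" using finS by (auto intro!: finite_PiE)
  have BV: "?B \<subseteq> ?V" by (rule PiE_mono) (auto simp: no_singleton_maps_def)
  have finB: "finite ?B" using finV BV finite_subset by blast
  have cardV: "card ?V = (2 ^ b) ^ (s * d)"
    using finS by (simp add: card_PiE s_def power_mult)
  have fibre: "card ?V * card {M \<in> unique_at i. vals S M = f} \<le> card \<Omega>" if f: "f \<in> ?V" for f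
  proof -
    have "card ?V * card {M \<in> unique_at i. vals S M = f} =
      (\<Sum>f'\<in>?V. card {M \<in> unique_at i. vals S M = f})" by simp
    also have "\<dots> \<le> (\<Sum>f'\<in>?V. card {M \<in> unique_at i. vals S M = f'})"
      by (intro sum_mono card_vals_le i S f)
    also have "\<dots> = card (\<Union>f'\<in>?V. {M \<in> unique_at i. vals S M = f'})"
      using finV finite_unique_at by (intro card_UN_disjoint[symmetric]) auto
    also have "\<dots> \<le> card \<Omega>"
      using finite_Omega by (intro card_mono) (auto simp: unique_at_def)
    finally show ?thesis .
  qed
  have "?E \<subseteq> (\<Union>f\<in>?B. {M \<in> unique_at i. vals S M = f})"
  proof
    fix M assume M: "M \<in> ?E"
    then have "vals S M \<in> ?B"
      using vals_mem[of S M]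
      unfolding no_singleton_maps_def uniquely_coloured_def
      by (auto simp: PiE_iff vals_def)
    with M show "M \<in> (\<Union>f\<in>?B. {M \<in> unique_at i. vals S M = f})" by auto
  qed
  then have "card ?E \<le> card (\<Union>f\<in>?B. {M \<in> unique_at i. vals S M = f})"
    using finB finite_unique_at by (intro card_mono) auto
  also have "\<dots> \<le> (\<Sum>f\<in>?B. card {M \<in> unique_at i. vals S M = f})"
    by (rule card_UN_le[OF finB])
  finally have "card ?V * card ?E \<le> (\<Sum>f\<in>?B. card ?V * card {M \<in> unique_at i. vals S M = f})"
    unfolding sum_distrib_left[symmetric] by (rule mult_le_mono2)
  also have "\<dots> \<le> (\<Sum>f\<in>?B. card \<Omega>)"
    using BV by (intro sum_mono fibre) auto
  also have "\<dots> = (card (no_singleton_maps S (2 ^ b)) ^ 2) ^ (2 * c) * card \<Omega>"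
    by (simp add: card_PiE d_eq flip: power_mult)
  also have "\<dots> \<le> ((2 * 2 ^ b * s) ^ s) ^ (2 * c) * card \<Omega>"
  proof -
    have "card S \<le> 2 ^ b" using S(2) by (rule order_trans) (rule power_increasing, auto simp: b_eq)
    from card_no_singleton_maps_squared[OF finS this]
    show ?thesis by (intro mult_right_mono power_mono) (auto simp: s_def)
  qed
  finally have "(2 ^ b) ^ (s * d) * card ?E \<le> ((2 * 2 ^ b * s) ^ s) ^ (2 * c) * card \<Omega>"
    unfolding cardV .
  also have "((2 * 2 ^ b * s) ^ s) ^ (2 * c) = (2 ^ b) ^ (2 * c * s) * (2 * s) ^ (2 * c * s)"
  proof -
    have "(a ^ s) ^ (2 * c) = a ^ (2 * c * s)" for a :: nat
      by (simp only: power_mult[symmetric] mult.commute)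
    moreover have "2 * 2 ^ b * s = 2 ^ b * (2 * s)" by simp
    ultimately show ?thesis by (simp only: power_mult_distrib)
  qed
  also have "(2 ^ b) ^ (s * d) = (2 ^ b) ^ (2 * c * s) * ((2 ^ b) ^ (2 * c * s) :: nat)"
  proof -
    have "s * d = 2 * c * s + 2 * c * s" by (simp add: d_eq)
    then show ?thesis by (simp only: power_add)
  qed
  finally have *: "(2 ^ b) ^ (2 * c * s) * card ?E \<le> (2 * s) ^ (2 * c * s) * card \<Omega>"
    unfolding mult.assoc mult_le_cancel1 by simp
  \<comment> \<open>The factor \<open>(2 * s) ^ (2 * c * s)\<close> replaces a division and is
    cancelled at the end, being positive.\<close>
  have "(2 * s) ^ (2 * c * s) * (card ?E * 2 ^ (2 * c * n * s)) =
      (2 ^ n * (2 * s)) ^ (2 * c * s) * card ?E"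
  proof -
    have "2 * c * n * s = n * (2 * c * s)" by simp
    then have "2 ^ (2 * c * n * s) = ((2 :: nat) ^ n) ^ (2 * c * s)" by (simp only: power_mult)
    then show ?thesis by (simp only: power_mult_distrib ac_simps)
  qed
  also have "\<dots> \<le> (2 ^ b) ^ (2 * c * s) * card ?E"
    using S(2) by (intro mult_right_mono power_mono) (auto simp: b_eq s_def power_add)
  also note *
  finally show ?thesis using spos unfolding mult_le_cancel1 by (simp add: s_def)
qed

text \<open>With \<open>q = 2 ^ (- c * n)\<close>, a set of \<open>s\<close> keys fails with
  probability at most \<open>q ^ (2 * s)\<close>, and there are at most \<open>q ^ (- s)\<close>
  such sets. Singletons never fail, so the sum of the remaining \<open>q ^ s\<close> starts at 2;
  this makes it of order \<open>q ^ 2\<close>, small enough for a union over \<open>c\<close>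
  levels.\<close>

lemma card_first_failure:
  assumes "i < c"
  shows "real (card (unique_at i - unique_at (Suc i))) \<le> 2 * (1 / 2 ^ (c * n)) ^ 2 * card \<Omega>"
proof -
  define q :: real where "q = 1 / 2 ^ (c * n)"
  let ?K = "2 ^ \<kappa> :: nat"
  define F where "F s = {S. S \<subseteq> words n (Suc i) \<and> card S = s}" for s
  define E where "E S = {M \<in> unique_at i. \<not> uniquely_coloured d (\<gamma> M) S}" for S
  have finF: "finite (F s)" for s using finite_words by (simp add: F_def)
  have finE: "finite (E S)" for S using finite_unique_at by (simp add: E_def)
  have "unique_at i - unique_at (Suc i) \<subseteq> (\<Union>s\<in>{2..?K}. \<Union>S\<in>F s. E S)"
  proof
    fix M assume M: "M \<in> unique_at i - unique_at (Suc i)"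
    then obtain S where S: "S \<subseteq> words n (Suc i)" "S \<noteq> {}" "card S \<le> ?K"
      and nc: "\<not> uniquely_coloured d (\<gamma> M) S"
      by (auto simp: unique_at_def unique_upto_def)
    have finS: "finite S" using S finite_words finite_subset by blast
    have "card S \<noteq> 1"
    proof
      assume "card S = 1"
      then obtain x where "S = {x}" by (auto simp: card_1_singleton_iff)
      with nc show False using c_pos by (auto simp: uniquely_coloured_def d_eq dest: spec[of _ 0])
    qed
    moreover have "card S > 0" using S finS by (simp add: card_gt_0_iff)
    ultimately have "card S \<in> {2..?K}" using S(3) by auto
    then show "M \<in> (\<Union>s\<in>{2..?K}. \<Union>S\<in>F s. E S)"
      using S nc M by (auto simp: F_def E_def)
  qed
  then have "card (unique_at i - unique_at (Suc i)) \<le> card (\<Union>s\<in>{2..?K}. \<Union>S\<in>F s. E S)"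
    using finF finE by (intro card_mono) auto
  also have "\<dots> \<le> (\<Sum>s\<in>{2..?K}. card (\<Union>S\<in>F s. E S))" by (rule card_UN_le) simp
  also have "\<dots> \<le> (\<Sum>s\<in>{2..?K}. \<Sum>S\<in>F s. card (E S))" by (intro sum_mono card_UN_le finF)
  finally have "real (card (unique_at i - unique_at (Suc i))) \<le>
      real (\<Sum>s\<in>{2..?K}. \<Sum>S\<in>F s. card (E S))"
    by (rule of_nat_mono)
  also have "\<dots> = (\<Sum>s\<in>{2..?K}. \<Sum>S\<in>F s. real (card (E S)))" by simp
  also have "\<dots> \<le> (\<Sum>s\<in>{2..?K}. q ^ s * card \<Omega>)"
  proof (rule sum_mono)
    fix s assume s: "s \<in> {2..?K}"
    have E: "real (card (E S)) \<le> q ^ (2 * s) * card \<Omega>" if "S \<in> F s" for S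
    proof -
      have "S \<noteq> {}" using that s by (auto simp: F_def)
      with card_not_coloured[OF assms, of S] that s
      have "card (E S) * 2 ^ (2 * c * n * s) \<le> card \<Omega>" by (auto simp: F_def E_def)
      then have "real (card (E S)) * 2 ^ (2 * c * n * s) \<le> card \<Omega>"
        by (metis of_nat_le_iff of_nat_mult of_nat_numeral of_nat_power)
      then have "real (card (E S)) \<le> card \<Omega> / 2 ^ (2 * c * n * s)"
        by (simp add: pos_le_divide_eq)
      moreover have "q ^ (2 * s) = 1 / 2 ^ (2 * c * n * s)"
        by (simp add: q_def power_one_over power_mult[symmetric] ac_simps)
      ultimately show ?thesis by simp
    qed
    have "card (F s) \<le> (2 ^ (c * n)) ^ s"
    proof -
      have "card (F s) = 2 ^ (n * Suc i) choose s"
        unfolding F_def using n_subsets[OF finite_words] card_words by metis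
      also have "\<dots> \<le> (2 ^ (n * Suc i)) ^ s"
        using binomial_fact_pow[of "2 ^ (n * Suc i)" s] by (rule order_trans[rotated]) simp
      also have "\<dots> \<le> (2 ^ (c * n)) ^ s"
        using assms mult_le_mono[of "Suc i" c n n] by (intro power_mono power_increasing) (auto simp: mult.commute)
      finally show ?thesis .
    qed
    then have F: "real (card (F s)) \<le> (2 ^ (c * n)) ^ s"
      by (metis of_nat_le_iff of_nat_numeral of_nat_power)
    have "(\<Sum>S\<in>F s. real (card (E S))) \<le> (\<Sum>S\<in>F s. q ^ (2 * s) * card \<Omega>)"
      by (intro sum_mono E)
    also have "\<dots> = real (card (F s)) * (q ^ (2 * s) * card \<Omega>)" by simp
    also have "\<dots> \<le> (2 ^ (c * n)) ^ s * (q ^ (2 * s) * card \<Omega>)"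
      using F by (intro mult_right_mono) (auto simp: q_def)
    also have "\<dots> = (2 ^ (c * n) * q) ^ s * q ^ s * card \<Omega>"
      by (simp add: power_mult_distrib mult_2 power_add)
    also have "2 ^ (c * n) * q = 1" by (simp add: q_def)
    finally show "(\<Sum>S\<in>F s. real (card (E S))) \<le> q ^ s * card \<Omega>" by simp
  qed
  also have "\<dots> = (\<Sum>s\<in>{2..?K}. q ^ s) * card \<Omega>" by (simp add: sum_distrib_right)
  also have "\<dots> \<le> 2 * q ^ 2 * card \<Omega>"
  proof (rule mult_right_mono)
    have "(2 :: real) ^ 1 \<le> 2 ^ (c * n)"
      using c_pos n_pos by (intro power_increasing) auto
    then have "0 \<le> q" "q \<le> 1 / 2" by (auto simp: q_def field_simps)
    then show "(\<Sum>s\<in>{2..?K}. q ^ s) \<le> 2 * q ^ 2"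
      using sum_geometric_from_two[of q ?K] by (smt (verit) one_le_power zero_le_power one_le_numeral)
  qed simp
  finally show ?thesis by (simp add: q_def)
qed

text \<open>Level 0 has a single key and is unique, so a failure at \<open>c\<close> implies a
  failing step among \<open>c\<close> many. The total \<open>2 * c * q ^ 2\<close> is at most
  \<open>q\<close> because \<open>2 * c \<le> 2 ^ c \<le> 2 ^ (c * n)\<close>.\<close>

theorem card_not_unique: "real (card (\<Omega> - unique_at c)) \<le> card \<Omega> / 2 ^ (c * n)"
proof -
  define q :: real where "q = 1 / 2 ^ (c * n)"
  have base: "unique_at 0 = \<Omega>"
  proof -
    have "uniquely_coloured d (\<gamma> M) S" if "S \<subseteq> words n 0" "S \<noteq> {}" for M S
    proof -
      have "S = {[]}" using that by (auto simp: words_def)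
      then show ?thesis using c_pos by (auto simp: uniquely_coloured_def d_eq intro!: exI[of _ 0])
    qed
    then show ?thesis by (auto simp: unique_at_def unique_upto_def)
  qed
  have "\<Omega> - unique_at m \<subseteq> (\<Union>i<m. unique_at i - unique_at (Suc i))" for m
    by (induction m) (auto simp: base lessThan_Suc)
  then have "card (\<Omega> - unique_at c) \<le> card (\<Union>i<c. unique_at i - unique_at (Suc i))"
    using finite_unique_at by (intro card_mono) auto
  also have "\<dots> \<le> (\<Sum>i<c. card (unique_at i - unique_at (Suc i)))" by (rule card_UN_le) simp
  finally have "real (card (\<Omega> - unique_at c)) \<le> (\<Sum>i<c. real (card (unique_at i - unique_at (Suc i))))"
    by (metis of_nat_le_iff of_nat_sum)
  also have "\<dots> \<le> (\<Sum>i<c. 2 * q ^ 2 * card \<Omega>)"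
    unfolding q_def by (intro sum_mono card_first_failure) auto
  also have "\<dots> = (2 * c * q) * (q * card \<Omega>)" by (simp add: power2_eq_square)
  also have "\<dots> \<le> 1 * (q * card \<Omega>)"
  proof (rule mult_right_mono)
    have "2 * c \<le> 2 ^ c"
    proof -
      obtain k where "c = Suc k" using c_pos gr0_implies_Suc by blast
      then show ?thesis by (simp only: power_Suc mult_le_mono2[OF Suc_leI[OF less_exp]])
    qed
    also have "\<dots> \<le> 2 ^ (c * n)" using n_pos by (intro power_increasing) auto
    finally have "real (2 * c) \<le> real (2 ^ (c * n))" by (rule of_nat_mono)
    then show "real (2 * c) * q \<le> 1" by (simp add: q_def field_simps)
  qed (simp add: q_def)
  finally show ?thesis by (simp add: q_def)
qed

end

section \<open>Structured programs for the word RAM\<close>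

datatype com = Do "instr list" | Seq com com (infixr ";;" 60) | Loop nat com

fun code_size :: "com \<Rightarrow> nat" where
  "code_size (Do ins) = length ins"
| "code_size (c1 ;; c2) = code_size c1 + code_size c2"
| "code_size (Loop r c) = code_size c + 2"

text \<open>Jump targets are absolute, so compilation takes the start address
  \<open>k\<close>.\<close>

fun code :: "nat \<Rightarrow> com \<Rightarrow> program" where
  "code k (Do ins) = ins"
| "code k (c1 ;; c2) = code k c1 @ code (k + code_size c1) c2"
| "code k (Loop r c) = Jump_Zero r (k + code_size c + 2) # code (Suc k) c @ [Jump k]"

lemma length_code [simp]: "length (code k c) = code_size c"
  by (induction c arbitrary: k) auto

type_synonym cfg = "(nat \<Rightarrow> nat) \<times> (nat \<Rightarrow> nat) \<times> (nat \<Rightarrow> nat)"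

fun at_pc :: "nat \<Rightarrow> cfg \<Rightarrow> state" where
  "at_pc k (R, M, Z) = \<lparr>pc = k, regs = R, mem = M, outp = Z\<rparr>"

lemma at_pc_simps [simp]:
  "pc (at_pc k \<sigma>) = k" "regs (at_pc k \<sigma>) = fst \<sigma>" "mem (at_pc k \<sigma>) = fst (snd \<sigma>)"
  "outp (at_pc k \<sigma>) = snd (snd \<sigma>)" "(at_pc k \<sigma>)\<lparr>pc := l\<rparr> = at_pc l \<sigma>"
  by (cases \<sigma>; simp)+

text \<open>Quantifying over the surrounding code makes the relation compositional. The time
  \<open>t\<close> is exact and common to all random outcomes, as \<open>run\<close> performs a
  prescribed number of steps.\<close>

definition executes :: "nat \<Rightarrow> nat \<Rightarrow> nat list \<Rightarrow> com \<Rightarrow> cfg \<Rightarrow> nat \<Rightarrow> cfg pmf \<Rightarrow> bool" where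
  "executes w sp inp c \<sigma> t \<mu> \<longleftrightarrow>
     (\<forall>pre post. run w sp (pre @ code (length pre) c @ post) inp t (at_pc (length pre) \<sigma>) =
        map_pmf (at_pc (length pre + code_size c)) \<mu>)"

lemma run_add: "run w sp p inp (s + t) \<sigma> = bind_pmf (run w sp p inp s \<sigma>) (run w sp p inp t)"
  by (induction s arbitrary: \<sigma>) (auto simp: bind_return_pmf bind_assoc_pmf intro!: bind_pmf_cong)

lemma executes_Seq:
  assumes "executes w sp inp c1 \<sigma> s \<mu>"
    and "\<And>\<sigma>'. \<sigma>' \<in> set_pmf \<mu> \<Longrightarrow> executes w sp inp c2 \<sigma>' t (f \<sigma>')"
  shows "executes w sp inp (c1 ;; c2) \<sigma> (s + t) (bind_pmf \<mu> f)"
  unfolding executes_def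
proof (intro allI)
  fix pre post :: program
  let ?k = "length pre"
  let ?p = "pre @ code ?k (c1 ;; c2) @ post"
  have "run w sp ?p inp s (at_pc ?k \<sigma>) = map_pmf (at_pc (?k + code_size c1)) \<mu>"
    using assms(1)[unfolded executes_def, rule_format, of pre "code (?k + code_size c1) c2 @ post"]
    by simp
  moreover have "run w sp ?p inp t (at_pc (?k + code_size c1) \<sigma>') =
      map_pmf (at_pc (?k + code_size (c1 ;; c2))) (f \<sigma>')" if "\<sigma>' \<in> set_pmf \<mu>" for \<sigma>'
    using assms(2)[OF that, unfolded executes_def, rule_format, of "pre @ code ?k c1" post]
    by (simp add: add.assoc)
  ultimately show "run w sp ?p inp (s + t) (at_pc ?k \<sigma>) =
      map_pmf (at_pc (?k + code_size (c1 ;; c2))) (bind_pmf \<mu> f)"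
    unfolding run_add by (auto simp: map_pmf_def bind_assoc_pmf bind_return_pmf intro!: bind_pmf_cong)
qed

lemma run_step:
  assumes "k < length p"
  shows "run w sp p inp (Suc t) (at_pc k \<sigma>) =
    bind_pmf (exec w sp inp (p ! k) (at_pc k \<sigma>)) (run w sp p inp t)"
  using assms by (simp add: step_def halted_def)

lemma executes_Loop_done:
  assumes "fst \<sigma> r = 0"
  shows "executes w sp inp (Loop r c) \<sigma> 1 (return_pmf \<sigma>)"
  unfolding executes_def One_nat_def using assms
  by (intro allI, subst run_step) (simp_all add: nth_append bind_return_pmf)

lemma executes_Loop_step:
  assumes "fst \<sigma> r \<noteq> 0" and "executes w sp inp c \<sigma> s \<mu>"
    and "\<And>\<sigma>'. \<sigma>' \<in> set_pmf \<mu> \<Longrightarrow> executes w sp inp (Loop r c) \<sigma>' t (f \<sigma>')"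
  shows "executes w sp inp (Loop r c) \<sigma> (Suc (s + Suc t)) (bind_pmf \<mu> f)"
  unfolding executes_def
proof (intro allI)
  fix pre post :: program
  let ?k = "length pre" and ?n = "code_size c"
  let ?p = "pre @ code ?k (Loop r c) @ post"
  have jump: "run w sp ?p inp (Suc t) (at_pc (Suc ?k + ?n) \<sigma>') = run w sp ?p inp t (at_pc ?k \<sigma>')" for \<sigma>'
  proof -
    have "?p ! (Suc ?k + ?n) = Jump ?k" by (simp add: nth_append)
    then show ?thesis by (subst run_step) (simp_all add: bind_return_pmf)
  qed
  have "run w sp ?p inp (Suc (s + Suc t)) (at_pc ?k \<sigma>) = run w sp ?p inp (s + Suc t) (at_pc (Suc ?k) \<sigma>)"
    using assms(1) by (subst run_step) (simp_all add: nth_append bind_return_pmf)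
  also have "\<dots> = bind_pmf (map_pmf (at_pc (Suc ?k + ?n)) \<mu>) (run w sp ?p inp (Suc t))"
    unfolding run_add
    using assms(2)[unfolded executes_def, rule_format, of "pre @ [Jump_Zero r (?k + ?n + 2)]"
        "Jump ?k # post"] by simp
  also have "\<dots> = bind_pmf \<mu> (\<lambda>\<sigma>'. run w sp ?p inp t (at_pc ?k \<sigma>'))"
    by (simp only: map_pmf_def bind_assoc_pmf bind_return_pmf jump)
  also have "\<dots> = bind_pmf \<mu> (\<lambda>\<sigma>'. map_pmf (at_pc (?k + code_size (Loop r c))) (f \<sigma>'))"
    using assms(3) by (intro bind_pmf_cong) (simp_all add: executes_def)
  also have "\<dots> = map_pmf (at_pc (?k + code_size (Loop r c))) (bind_pmf \<mu> f)"
    by (simp add: map_bind_pmf)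
  finally show "run w sp ?p inp (Suc (s + Suc t)) (at_pc ?k \<sigma>) =
    map_pmf (at_pc (?k + code_size (Loop r c))) (bind_pmf \<mu> f)" .
qed

lemma executes_Do_Cons:
  assumes "\<And>k. exec w sp inp i (at_pc k \<sigma>) = map_pmf (at_pc (Suc k)) \<mu>"
    and "\<And>\<sigma>'. \<sigma>' \<in> set_pmf \<mu> \<Longrightarrow> executes w sp inp (Do ins) \<sigma>' t (f \<sigma>')"
  shows "executes w sp inp (Do (i # ins)) \<sigma> (Suc t) (bind_pmf \<mu> f)"
  unfolding executes_def
proof (intro allI)
  fix pre post :: program
  let ?k = "length pre"
  let ?p = "pre @ code ?k (Do (i # ins)) @ post"
  have "run w sp ?p inp (Suc t) (at_pc ?k \<sigma>) =
      bind_pmf \<mu> (\<lambda>\<sigma>'. run w sp ?p inp t (at_pc (Suc ?k) \<sigma>'))"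
    by (subst run_step) (simp_all add: assms(1) map_pmf_def bind_assoc_pmf bind_return_pmf)
  also have "\<dots> = bind_pmf \<mu> (\<lambda>\<sigma>'. map_pmf (at_pc (?k + code_size (Do (i # ins)))) (f \<sigma>'))"
    using assms(2)[unfolded executes_def, rule_format, of _ "pre @ [i]" post]
    by (intro bind_pmf_cong) simp_all
  also have "\<dots> = map_pmf (at_pc (?k + code_size (Do (i # ins)))) (bind_pmf \<mu> f)"
    by (simp add: map_bind_pmf)
  finally show "run w sp ?p inp (Suc t) (at_pc ?k \<sigma>) =
    map_pmf (at_pc (?k + code_size (Do (i # ins)))) (bind_pmf \<mu> f)" .
qed

lemma executes_Do_Nil: "executes w sp inp (Do []) \<sigma> 0 (return_pmf \<sigma>)"
  by (simp add: executes_def)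

lemma executes_Random:
  assumes "fst \<sigma> a = 0"
  shows "executes w sp inp (Do [Random r a]) \<sigma> 1
    (map_pmf (\<lambda>v. ((fst \<sigma>)(r := v), snd \<sigma>)) (pmf_of_set {..<2 ^ w}))"
proof -
  let ?\<mu> = "map_pmf (\<lambda>v. ((fst \<sigma>)(r := v), snd \<sigma>)) (pmf_of_set {..<2 ^ w})"
  have fin: "finite {..<2 ^ w :: nat}" "{..<2 ^ w :: nat} \<noteq> {}" by (auto simp: lessThan_empty_iff)
  then have set: "set_pmf (pmf_of_set {..<2 ^ w :: nat}) = {..<2 ^ w}" by (intro set_pmf_of_set)
  have "executes w sp inp (Do [Random r a]) \<sigma> (Suc 0) (bind_pmf ?\<mu> return_pmf)"
  proof (rule executes_Do_Cons)
    show "exec w sp inp (Random r a) (at_pc k \<sigma>) = map_pmf (at_pc (Suc k)) ?\<mu>" for k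
      using assms
      by (cases \<sigma>) (auto simp: set pmf.map_comp o_def set_reg_def intro!: pmf.map_cong)
  qed (rule executes_Do_Nil)
  then show ?thesis by (simp add: bind_return_pmf')
qed

section \<open>Reasoning about deterministic code\<close>

lemma wrapped_diff: "y \<le> x \<Longrightarrow> x - y < 2 ^ w \<Longrightarrow> (2 ^ w + x - y) mod 2 ^ w = (x - y :: nat)"
proof -
  assume "y \<le> x" "x - y < 2 ^ w"
  moreover from this have "2 ^ w + x - y = (x - y) + 2 ^ w" by simp
  ultimately show ?thesis by (simp only: mod_add_self2 mod_less)
qed

fun exact_val :: "binop \<Rightarrow> nat \<Rightarrow> nat \<Rightarrow> nat" where
  "exact_val Add a b = a + b"
| "exact_val Sub a b = a - b"
| "exact_val Mul a b = a * b"
| "exact_val Div a b = a div b"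
| "exact_val Mod a b = a mod b"
| "exact_val And a b = a AND b"
| "exact_val Or a b = a OR b"
| "exact_val Xor a b = a XOR b"
| "exact_val Shl a b = a * 2 ^ b"
| "exact_val Shr a b = a div 2 ^ b"
| "exact_val Less a b = of_bool (a < b)"
| "exact_val Eq a b = of_bool (a = b)"

lemma binop_val_exact:
  "exact_val f a b < 2 ^ w \<Longrightarrow> (f = Sub \<Longrightarrow> b \<le> a) \<Longrightarrow> binop_val w f a b mod 2 ^ w = exact_val f a b"
  by (cases f) (simp_all add: wrapped_diff)

text \<open>Not the weakest precondition: overflow and underflow are ruled out, so no modular arithmetic remains.\<close>

fun wp :: "nat \<Rightarrow> nat \<Rightarrow> nat list \<Rightarrow> instr list \<Rightarrow>
    ((nat \<Rightarrow> nat) \<Rightarrow> (nat \<Rightarrow> nat) \<Rightarrow> (nat \<Rightarrow> nat) \<Rightarrow> bool) \<Rightarrow>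
    (nat \<Rightarrow> nat) \<Rightarrow> (nat \<Rightarrow> nat) \<Rightarrow> (nat \<Rightarrow> nat) \<Rightarrow> bool" where
  "wp w sp inp [] Q R M Z = Q R M Z"
| "wp w sp inp (Const r v # ins) Q R M Z =
     (v < 2 ^ w \<and> wp w sp inp ins Q (R(r := v)) M Z)"
| "wp w sp inp (Word_Size r # ins) Q R M Z = wp w sp inp ins Q (R(r := w)) M Z"
| "wp w sp inp (Binop f r a b # ins) Q R M Z =
     (exact_val f (R a) (R b) < 2 ^ w \<and> (f = Sub \<longrightarrow> R b \<le> R a) \<and>
      wp w sp inp ins Q (R(r := exact_val f (R a) (R b))) M Z)"
| "wp w sp inp (Load r a # ins) Q R M Z =
     (R a < sp \<and> M (R a) < 2 ^ w \<and> wp w sp inp ins Q (R(r := M (R a))) M Z)"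
| "wp w sp inp (Store a b # ins) Q R M Z =
     (R a < sp \<and> wp w sp inp ins Q R (M(R a := R b)) Z)"
| "wp w sp inp (Input r a # ins) Q R M Z =
     (R a < length inp \<and> inp ! R a < 2 ^ w \<and> wp w sp inp ins Q (R(r := inp ! R a)) M Z)"
| "wp w sp inp (Output a b # ins) Q R M Z = wp w sp inp ins Q R M (Z(R a := R b))"
| "wp w sp inp (Random _ _ # ins) Q R M Z = False"
| "wp w sp inp (Jump _ # ins) Q R M Z = False"
| "wp w sp inp (Jump_Zero _ _ # ins) Q R M Z = False"

lemma executes_Do:
  assumes "wp w sp inp ins Q R M Z"
  shows "\<exists>R' M' Z'. executes w sp inp (Do ins) (R, M, Z) (length ins) (return_pmf (R', M', Z')) \<and> Q R' M' Z'"
  using assms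
proof (induction ins arbitrary: R M Z)
  case Nil
  then show ?case using executes_Do_Nil by force
next
  case (Cons i ins)
  obtain R1 M1 Z1 where exec: "\<And>k. exec w sp inp i (at_pc k (R, M, Z)) =
      map_pmf (at_pc (Suc k)) (return_pmf (R1, M1, Z1))"
    and wp: "wp w sp inp ins Q R1 M1 Z1"
    using Cons.prems by (cases i) (auto simp: set_reg_def binop_val_exact simp del: fun_upd_apply)
  from Cons.IH[OF wp] obtain R' M' Z' where
    "executes w sp inp (Do ins) (R1, M1, Z1) (length ins) (return_pmf (R', M', Z'))" and Q: "Q R' M' Z'"
    by blast
  then have "executes w sp inp (Do (i # ins)) (R, M, Z) (Suc (length ins))
      (bind_pmf (return_pmf (R1, M1, Z1)) (\<lambda>_. return_pmf (R', M', Z')))"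
    using exec by (intro executes_Do_Cons) auto
  with Q show ?case by (auto simp: bind_return_pmf)
qed

text \<open>For code without random choices, hence the point mass. The exact time may vary with the
  start and is only bounded.\<close>

definition triple where
  "triple w sp inp P c t Q \<longleftrightarrow> (\<forall>R M Z. P R M Z \<longrightarrow>
     (\<exists>s R' M' Z'. s \<le> t \<and> executes w sp inp c (R, M, Z) s (return_pmf (R', M', Z')) \<and> Q R' M' Z'))"

lemma triple_Do:
  assumes "\<And>R M Z. P R M Z \<Longrightarrow> wp w sp inp ins Q R M Z" and "length ins = t"
  shows "triple w sp inp P (Do ins) t Q"
  unfolding triple_def using executes_Do[OF assms(1)] assms(2) by blast

lemma triple_mono: "triple w sp inp P c s Q \<Longrightarrow> s \<le> t \<Longrightarrow> triple w sp inp P c t Q"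
  unfolding triple_def by (meson order_trans)

lemma triple_Seq:
  assumes "triple w sp inp P c1 t1 Q" "triple w sp inp Q c2 t2 S"
  shows "triple w sp inp P (c1 ;; c2) (t1 + t2) S"
  unfolding triple_def
proof (intro allI impI)
  fix R M Z assume "P R M Z"
  with assms(1) obtain s1 R1 M1 Z1 where 1: "s1 \<le> t1"
    "executes w sp inp c1 (R, M, Z) s1 (return_pmf (R1, M1, Z1))" "Q R1 M1 Z1"
    unfolding triple_def by blast
  with assms(2) obtain s2 R2 M2 Z2 where 2: "s2 \<le> t2"
    "executes w sp inp c2 (R1, M1, Z1) s2 (return_pmf (R2, M2, Z2))" "S R2 M2 Z2"
    unfolding triple_def by blast
  have "executes w sp inp (c1 ;; c2) (R, M, Z) (s1 + s2)
      (bind_pmf (return_pmf (R1, M1, Z1)) (\<lambda>_. return_pmf (R2, M2, Z2)))"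
    using 1 2 by (intro executes_Seq) auto
  with 1 2 show "\<exists>s R' M' Z'. s \<le> t1 + t2 \<and>
      executes w sp inp (c1 ;; c2) (R, M, Z) s (return_pmf (R', M', Z')) \<and> S R' M' Z'"
    by (intro exI[of _ "s1 + s2"] exI) (auto simp: bind_return_pmf)
qed

text \<open>\<open>I k\<close> is the invariant with \<open>k\<close> rounds to go. A round costs
  its body, the test and the jump back; the last test adds one step.\<close>

lemma triple_Loop:
  assumes counter: "\<And>k R M Z. I k R M Z \<Longrightarrow> R r = k"
    and body: "\<And>k. k < m \<Longrightarrow> triple w sp inp (I (Suc k)) c t (I k)"
  shows "triple w sp inp (I m) (Loop r c) (m * (t + 2) + 1) (I 0)"
  using body
proof (induction m)
  case 0
  show ?case unfolding triple_def
  proof (intro allI impI)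
    fix R M Z assume "I 0 R M Z"
    then show "\<exists>s R' M' Z'. s \<le> 0 * (t + 2) + 1 \<and>
        executes w sp inp (Loop r c) (R, M, Z) s (return_pmf (R', M', Z')) \<and> I 0 R' M' Z'"
      using executes_Loop_done[of "(R, M, Z)" r w sp inp c] counter by force
  qed
next
  case (Suc m)
  show ?case unfolding triple_def
  proof (intro allI impI)
    fix R M Z assume I: "I (Suc m) R M Z"
    with Suc.prems obtain s1 R1 M1 Z1 where 1: "s1 \<le> t"
      "executes w sp inp c (R, M, Z) s1 (return_pmf (R1, M1, Z1))" "I m R1 M1 Z1"
      unfolding triple_def by blast
    moreover have "triple w sp inp (I m) (Loop r c) (m * (t + 2) + 1) (I 0)"
      using Suc by auto
    ultimately obtain s2 R2 M2 Z2 where 2: "s2 \<le> m * (t + 2) + 1"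
      "executes w sp inp (Loop r c) (R1, M1, Z1) s2 (return_pmf (R2, M2, Z2))" "I 0 R2 M2 Z2"
      unfolding triple_def by blast
    have "executes w sp inp (Loop r c) (R, M, Z) (Suc (s1 + Suc s2))
        (bind_pmf (return_pmf (R1, M1, Z1)) (\<lambda>_. return_pmf (R2, M2, Z2)))"
      using 1 2 counter[OF I] by (intro executes_Loop_step) auto
    with 1 2 show "\<exists>s R' M' Z'. s \<le> Suc m * (t + 2) + 1 \<and>
        executes w sp inp (Loop r c) (R, M, Z) s (return_pmf (R', M', Z')) \<and> I 0 R' M' Z'"
      by (intro exI[of _ "Suc (s1 + Suc s2)"] exI) (auto simp: bind_return_pmf)
  qed
qed

section \<open>Random initialisation of the table\<close>

definition fill_random :: com where
  "fill_random = Loop 22 (Do [Random 23 0] ;;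
     Do [Binop Sub 22 22 1, Binop Add 24 11 22, Store 24 23])"

text \<open>The result of this loop is random, so the induction is done on \<open>executes\<close>
  directly. A pass fills the topmost missing cell, and the product distribution splits into that
  coordinate and the rest.\<close>

lemma executes_fill_random:
  assumes "R 0 = 0" "R 1 = 1" "R 11 = A" "R 22 = k" "A + k \<le> sp" "sp \<le> 2 ^ w" "k < 2 ^ w"
  shows "\<exists>\<mu>. executes w sp inp fill_random (R, M, Z) (k * 6 + 1) \<mu> \<and>
    map_pmf (\<lambda>\<sigma>. fst (snd \<sigma>)) \<mu> =
      map_pmf (\<lambda>f a. if a \<in> {A..<A + k} then f a else M a)
        (Pi_pmf {A..<A + k} 0 (\<lambda>_. pmf_of_set {..<2 ^ w}))"
  using assms
proof (induction k arbitrary: R M)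
  case 0
  then show ?case
    using executes_Loop_done[of "(R, M, Z)" 22 w sp inp]
    by (intro exI[of _ "return_pmf (R, M, Z)"]) (auto simp: fill_random_def)
next
  case (Suc k)
  let ?U = "pmf_of_set {..<2 ^ w :: nat}"
  let ?body = "Do [Binop Sub 22 22 1, Binop Add 24 11 22, Store 24 23]"
  have step: "\<exists>\<mu>. executes w sp inp (?body) (R(23 := v), M, Z) 3 (return_pmf \<mu>) \<and>
      (\<exists>R'. \<mu> = (R', M(A + k := v), Z) \<and> R' 0 = 0 \<and> R' 1 = 1 \<and> R' 11 = A \<and> R' 22 = k)" for v
  proof -
    have "wp w sp inp [Binop Sub 22 22 1, Binop Add 24 11 22, Store 24 23]
       (\<lambda>R' M' Z'. M' = M(A + k := v) \<and> Z' = Z \<and> R' 0 = 0 \<and> R' 1 = 1 \<and> R' 11 = A \<and> R' 22 = k)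
       (R(23 := v)) M Z"
      using Suc.prems by simp
    from executes_Do[OF this] show ?thesis by (auto simp: numeral_3_eq_3)
  qed
  then obtain g where g: "\<And>v. executes w sp inp ?body (R(23 := v), M, Z) 3 (return_pmf (g v))"
    "\<And>v. \<exists>R'. g v = (R', M(A + k := v), Z) \<and> R' 0 = 0 \<and> R' 1 = 1 \<and> R' 11 = A \<and> R' 22 = k"
    by metis
  have "\<exists>\<mu>. executes w sp inp fill_random (g v) (k * 6 + 1) \<mu> \<and>
      map_pmf (\<lambda>\<sigma>. fst (snd \<sigma>)) \<mu> =
        map_pmf (\<lambda>f a. if a \<in> {A..<A + k} then f a else (M(A + k := v)) a)
          (Pi_pmf {A..<A + k} 0 (\<lambda>_. ?U))" for v
  proof -
    from g(2)[of v] obtain R' where R': "g v = (R', M(A + k := v), Z)"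
      "R' 0 = 0" "R' 1 = 1" "R' 11 = A" "R' 22 = k" by blast
    show ?thesis unfolding R'(1) using Suc.prems R' by (intro Suc.IH) auto
  qed
  then obtain \<nu> where \<nu>: "\<And>v. executes w sp inp fill_random (g v) (k * 6 + 1) (\<nu> v)"
    "\<And>v. map_pmf (\<lambda>\<sigma>. fst (snd \<sigma>)) (\<nu> v) =
        map_pmf (\<lambda>f a. if a \<in> {A..<A + k} then f a else (M(A + k := v)) a)
          (Pi_pmf {A..<A + k} 0 (\<lambda>_. ?U))"
    by metis
  define \<mu> where "\<mu> = bind_pmf ?U (\<lambda>v. \<nu> v)"
  have rand: "executes w sp inp (Do [Random 23 0]) (R, M, Z) 1 (map_pmf (\<lambda>v. (R(23 := v), M, Z)) ?U)"
    using executes_Random[of "(R, M, Z)" 0 w sp inp 23] Suc.prems by simp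
  have "executes w sp inp (Do [Random 23 0] ;; ?body) (R, M, Z) (1 + 3)
      (bind_pmf (map_pmf (\<lambda>v. (R(23 := v), M, Z)) ?U) (\<lambda>\<sigma>. return_pmf (g (fst \<sigma> 23))))"
    using g(1) by (intro executes_Seq[OF rand]) auto
  then have body: "executes w sp inp (Do [Random 23 0] ;; ?body) (R, M, Z) 4 (map_pmf g ?U)"
    by (simp add: map_pmf_def bind_assoc_pmf bind_return_pmf)
  \<comment> \<open>The loop rule wants the continuation as a function of the configuration, so the
    word drawn in this pass is read off the cell just written.\<close>
  have memg: "fst (snd (g v)) (A + k) = v" for v using g(2)[of v] by auto
  have "executes w sp inp fill_random (R, M, Z) (Suc (4 + Suc (k * 6 + 1)))
      (bind_pmf (map_pmf g ?U) (\<lambda>\<sigma>. \<nu> (fst (snd \<sigma>) (A + k))))"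
    unfolding fill_random_def
  proof (rule executes_Loop_step[OF _ body])
    fix \<sigma>' assume "\<sigma>' \<in> set_pmf (map_pmf g ?U)"
    then obtain v where "\<sigma>' = g v" by auto
    then show "executes w sp inp (Loop 22 (Do [Random 23 0] ;; ?body)) \<sigma>' (k * 6 + 1)
        (\<nu> (fst (snd \<sigma>') (A + k)))"
      using \<nu>(1)[of v] unfolding fill_random_def by (simp add: memg)
  qed (use Suc.prems in simp)
  then have "executes w sp inp fill_random (R, M, Z) (Suc k * 6 + 1) \<mu>"
    by (simp add: \<mu>_def map_pmf_def bind_assoc_pmf bind_return_pmf memg)
  moreover have "map_pmf (\<lambda>\<sigma>. fst (snd \<sigma>)) \<mu> =
      map_pmf (\<lambda>f a. if a \<in> {A..<A + Suc k} then f a else M a)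
        (Pi_pmf {A..<A + Suc k} 0 (\<lambda>_. ?U))"
  proof -
    have "{A..<A + Suc k} = insert (A + k) {A..<A + k}" by auto
    then have "Pi_pmf {A..<A + Suc k} 0 (\<lambda>_. ?U) =
      map_pmf (\<lambda>(y, f). f(A + k := y)) (pair_pmf ?U (Pi_pmf {A..<A + k} 0 (\<lambda>_. ?U)))"
      by (simp add: Pi_pmf_insert)
    then have "map_pmf (\<lambda>f a. if a \<in> {A..<A + Suc k} then f a else M a)
        (Pi_pmf {A..<A + Suc k} 0 (\<lambda>_. ?U)) =
      map_pmf (\<lambda>(y, f) a. if a \<in> {A..<A + k} then f a else (M(A + k := y)) a)
        (pair_pmf ?U (Pi_pmf {A..<A + k} 0 (\<lambda>_. ?U)))"
      by (auto simp: pmf.map_comp fun_eq_iff intro!: pmf.map_cong)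
    also have "\<dots> = bind_pmf ?U (\<lambda>y. map_pmf (\<lambda>f a. if a \<in> {A..<A + k} then f a else (M(A + k := y)) a)
        (Pi_pmf {A..<A + k} 0 (\<lambda>_. ?U)))"
      by (simp add: pair_pmf_def map_pmf_def bind_assoc_pmf bind_return_pmf)
    also have "\<dots> = map_pmf (\<lambda>\<sigma>. fst (snd \<sigma>)) \<mu>"
      by (simp add: \<mu>_def map_bind_pmf \<nu>(2))
    finally show ?thesis ..
  qed
  ultimately show ?case by blast
qed

lemma mixed_radix_less: "q < m \<Longrightarrow> r < t \<Longrightarrow> q * t + r < m * (t :: nat)"
proof -
  assume "q < m" "r < t"
  then have "q * t + r < Suc q * t" by simp
  also have "\<dots> \<le> m * t" using \<open>q < m\<close> by (intro mult_le_mono1) simp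
  finally show ?thesis .
qed

lemma mixed_radix_inj:
  assumes "q * t + r = q' * t + r'" "r < t" "r' < (t :: nat)"
  shows "q = q' \<and> r = r'"
proof -
  have "(q * t + r) div t = q" "(q' * t + r') div t = q'" using assms(2,3) by auto
  with assms(1) show ?thesis by auto
qed

section \<open>Memory layout\<close>

text \<open>
  A table entry consists of \<open>d\<close> fields of \<open>b\<close> bits. A word holds \<open>g\<close> fields, so either \<open>P\<close> entries
  share a word (and \<open>L = 1\<close>), or an entry occupies \<open>L\<close> words (and \<open>P = 1\<close>). There are \<open>N\<close> entries in
  \<open>W\<close> words from address \<open>A\<close> on. The words below \<open>A\<close> hold \<open>c\<close>, \<open>n\<close>, \<open>\<kappa>\<close> and three buffers of \<open>L\<close>
  words, the first of which is constantly zero. If \<open>g = 0\<close>, then \<open>L = 1\<close> because \<open>x div 0 = 0\<close>.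
\<close>

locale params =
  fixes c n \<kappa> w :: nat
  assumes c_pos: "c > 0" and n_pos: "n > 0" and k_pos: "\<kappa> > 0" and w_pos: "w > 0"
begin

definition "b = n + \<kappa> + 1"
definition "d = 4 * c"
definition "g = w div b"
definition "P = g div d + of_bool (g div d = 0)"
definition "L = (d - 1) div g + 1"
definition "A = 3 + 3 * L"
definition "N = c * d * 2 ^ n * 2 ^ b"
definition "W = (N div P + 1) * L"

lemma P_pos: "P > 0" by (cases "g div d = 0") (auto simp: P_def)
lemma L_pos: "L > 0" by (simp add: L_def)
lemma d_pos: "d > 0" using c_pos by (simp add: d_def)

lemma g_b_le: "g * b \<le> w" by (simp add: g_def)

lemma P_L_cases: "P = 1 \<or> L = 1 \<and> d \<le> g \<and> P * d \<le> g"
proof (cases "g div d = 0")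
  case False
  then have "d \<le> g" using d_pos by (simp add: div_eq_0_iff)
  moreover have "g div d * d \<le> g" by simp
  ultimately show ?thesis using False d_pos by (auto simp: P_def L_def)
qed (simp add: P_def)

text \<open>Rounding \<open>w / b\<close> down to \<open>g \<ge> 1\<close> loses at most a factor 2,
  since \<open>w < (g + 1) * b \<le> 2 * g * b\<close>.\<close>

lemma words_per_entry_bound:
  assumes "b \<le> w"
  shows "real L \<le> 1 + 2 * d * b / w"
proof -
  have g: "g > 0" using assms by (simp add: g_def b_def div_greater_zero_iff)
  have "w < (g + 1) * b"
    unfolding g_def using dividend_less_div_times[of b w] by (simp add: b_def)
  also have "\<dots> \<le> 2 * g * b" using g by (intro mult_le_mono) auto
  finally have "real w \<le> real (2 * g * b)" by linarith
  then have "d / g \<le> 2 * d * b / w"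
    using g w_pos d_pos by (simp add: field_simps)
  moreover have "real ((d - 1) div g) \<le> real (d - 1) / real g" by (rule of_nat_div_le_of_nat)
  moreover have "real (d - 1) / real g \<le> d / g" by (intro divide_right_mono) auto
  ultimately show ?thesis by (simp add: L_def)
qed

text \<open>The bound has to hold for every \<open>w\<close>. If a field does not fit into a word,
  then \<open>g = 0\<close>, each entry gets one word, and \<open>w < b\<close> leaves ample room.
  Otherwise the tables carry \<open>N * d * b \<le> 64 * X * w\<close> bits, and rounding to whole
  words costs a factor of at most 8. An additive word is absorbed by the ceiling, which is at least
  1.\<close>

lemma space_bound:
  "real (16 * W) \<le> 10000 * of_int \<lceil>2 ^ (2 * n + \<kappa>) * real c ^ 3 * real (n + \<kappa>) / real w\<rceil>"
proof -
  define X where "X = 2 ^ (2 * n + \<kappa>) * real c ^ 3 * real (n + \<kappa>) / real w"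
  have X_pos: "X > 0" unfolding X_def using c_pos n_pos w_pos by (intro divide_pos_pos mult_pos_pos) auto
  define Y :: real where "Y = of_int \<lceil>X\<rceil>"
  have ceil: "1 \<le> Y" "X \<le> Y" using X_pos by (auto simp: Y_def)
  have bX: "b \<le> 2 * (n + \<kappa>)" using n_pos by (simp add: b_def)
  have N_eq: "real N = 8 * 2 ^ (2 * n + \<kappa>) * real c ^ 2"
  proof -
    have "n + b = Suc (2 * n + \<kappa>)" by (simp add: b_def)
    then have "(2 :: real) ^ n * 2 ^ b = 2 * 2 ^ (2 * n + \<kappa>)" by (simp only: power_add[symmetric] power_Suc)
    moreover have "real N = 4 * real c ^ 2 * (2 ^ n * 2 ^ b)" by (simp add: N_def d_def power2_eq_square)
    ultimately show ?thesis by simp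
  qed
  have NX: "real N * (d * b) / w \<le> 64 * X"
  proof -
    have "real N * (d * b) \<le> real N * (d * (2 * (n + \<kappa>)))"
      using bX by (intro mult_left_mono) (auto simp flip: of_nat_mult of_nat_add)
    also have "\<dots> = 64 * (X * w)"
      using w_pos by (simp add: X_def N_eq d_def power2_eq_square power3_eq_cube)
    finally show ?thesis using w_pos by (simp add: field_simps)
  qed
  have N_pos: "N > 0" using c_pos d_pos by (simp add: N_def)
  have "real W \<le> 512 * Y"
  proof (cases "b \<le> w")
    case False
    then have g: "g = 0" by (simp add: g_def)
    then have W: "W = N + 1" by (simp add: W_def P_def L_def)
    have "8 * 2 ^ (2 * n + \<kappa>) * real c ^ 2 * 1 \<le> 8 * 2 ^ (2 * n + \<kappa>) * real c ^ 2 * (c * (n + \<kappa>) / w)"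
    proof (rule mult_left_mono)
      have "w * 1 \<le> (n + \<kappa>) * c" using False c_pos by (intro mult_le_mono) (auto simp: b_def)
      then have "real w \<le> real (c * (n + \<kappa>))" by (simp add: mult.commute del: of_nat_mult of_nat_add)
      then show "1 \<le> real (c * (n + \<kappa>)) / real w" using w_pos by (simp add: field_simps)
    qed simp
    also have "\<dots> = 8 * X" by (simp add: X_def power2_eq_square power3_eq_cube)
    finally have "real N \<le> 8 * X" using N_eq by simp
    then show ?thesis using ceil W by simp
  next
    case True
    then have gpos: "g > 0" by (simp add: g_def b_def div_greater_zero_iff)
    have "w < (g + 1) * b"
      unfolding g_def using dividend_less_div_times[of b w] by (simp add: b_def)
    also have "\<dots> \<le> 2 * g * b" using gpos by (intro mult_le_mono) auto
    finally have wg: "w \<le> 2 * g * b" by simp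
    show ?thesis
    proof (cases "d \<le> g")
      case True
      then have L: "L = 1" using d_pos by (simp add: L_def)
      have gd: "g div d > 0" using True d_pos by (simp add: div_greater_zero_iff)
      then have P: "P = g div d" by (simp add: P_def)
      have "g < (P + 1) * d"
        unfolding P using dividend_less_div_times[of d g] d_pos by simp
      also have "\<dots> \<le> 2 * P * d" using P_pos by (intro mult_le_mono) auto
      finally have "2 * g * b \<le> 2 * (2 * P * d) * b" by (intro mult_le_mono) auto
      with wg have "w \<le> 2 * (2 * P * d) * b" by (rule order_trans)
      also have "\<dots> = 4 * P * (d * b)" by simp
      finally have "real w \<le> real (4 * P * (d * b))" by (rule of_nat_mono)
      then have "1 / P \<le> 4 * (d * b) / w" using P_pos w_pos by (simp add: field_simps)
      then have "real N * (1 / P) \<le> real N * (4 * (d * b) / w)" by (intro mult_left_mono) auto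
      also have "\<dots> = 4 * (real N * (d * b) / w)" by simp
      also have "\<dots> \<le> 256 * X" using NX by linarith
      finally have "real N / P \<le> 256 * X" by simp
      moreover have "real (N div P) \<le> real N / P" by (rule of_nat_div_le_of_nat)
      ultimately show ?thesis using ceil by (simp add: W_def L)
    next
      case False
      then have P: "P = 1" by (simp add: P_def)
      have "(d - 1) div g * g \<le> d" using div_times_less_eq_dividend[of "d - 1" g] by linarith
      then have "L * g \<le> 2 * d" using False by (simp add: L_def algebra_simps)
      then have *: "L * g * (2 * b) \<le> 2 * d * (2 * b)" by (rule mult_le_mono1)
      have "L * w \<le> L * (2 * g * b)" using wg by (rule mult_le_mono2)
      also have "\<dots> = L * g * (2 * b)" by (simp only: ac_simps)
      also note *
      also have "2 * d * (2 * b) = 4 * (d * b)" by simp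
      finally have "L * w \<le> 4 * (d * b)" .
      then have "real L * w \<le> 4 * (d * b)" by (metis of_nat_le_iff of_nat_mult of_nat_numeral)
      then have "real L \<le> 4 * (d * b) / w" using w_pos by (simp add: field_simps)
      then have "(2 * real N) * L \<le> 2 * real N * (4 * (d * b) / w)" by (intro mult_left_mono) auto
      also have "\<dots> = 8 * (real N * (d * b) / w)" by simp
      also have "\<dots> \<le> 512 * X" using NX by linarith
      finally have "2 * real N * L \<le> 512 * X" .
      moreover have "real W \<le> 2 * real N * L"
      proof -
        have "W \<le> 2 * N * L" unfolding W_def P using N_pos by (intro mult_le_mono) auto
        then have "real W \<le> real (2 * N * L)" by (rule of_nat_mono)
        then show ?thesis by simp
      qed
      ultimately show ?thesis using ceil by linarith
    qed
  qed
  then show ?thesis using ceil unfolding X_def[symmetric] Y_def[symmetric] by simp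
qed

end

text \<open>
  The factor 16 leaves room for the buffers and makes \<open>N < 2 ^ w\<close>, also when many entries share a word.
\<close>

locale layout = params +
  assumes fits: "16 * W \<le> 2 ^ w"
begin

text \<open>If at most 8 entries share a word, \<open>N < 8 * W\<close>. Otherwise 9 entries fit
  into a word, so \<open>36 * (c * b) \<le> w\<close>, and the crude estimate
  \<open>N \<le> 2 ^ (5 * c + n + b)\<close> is already below \<open>2 ^ w\<close>.\<close>

lemma N_less: "N < 2 ^ w"
proof (cases "P \<le> 8")
  case True
  have "N < (N div P + 1) * P" using dividend_less_div_times[of P N] P_pos by simp
  also have "\<dots> \<le> W * 8"
  proof (rule mult_le_mono)
    have "(N div P + 1) * 1 \<le> (N div P + 1) * L" using L_pos by (intro mult_le_mono) auto
    then show "N div P + 1 \<le> W" by (simp add: W_def)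
  qed (rule True)
  also have "\<dots> \<le> 16 * W" by simp
  finally show ?thesis using fits by simp
next
  case False
  then have "P * d \<le> g" using P_L_cases by auto
  have "9 * d * b \<le> P * d * b" using False by (intro mult_le_mono) auto
  also have "\<dots> \<le> g * b" using \<open>P * d \<le> g\<close> by (intro mult_le_mono) auto
  also note g_b_le
  finally have w: "36 * (c * b) \<le> w" by (simp add: d_def)
  have "c < 2 ^ c" "d < 2 ^ d" by (rule less_exp)+
  then have "N \<le> 2 ^ c * 2 ^ d * 2 ^ n * 2 ^ b" unfolding N_def by (intro mult_le_mono) auto
  also have "\<dots> = 2 ^ (5 * c + n + b)" by (simp add: d_def flip: power_add)
  also have "\<dots> < 2 ^ w"
  proof (rule power_strict_increasing)
    have "c * 1 \<le> c * b" "1 * b \<le> c * b" using c_pos by (intro mult_le_mono; simp add: b_def)+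
    then show "5 * c + n + b < w" using w c_pos by (simp add: b_def)
  qed simp
  finally show ?thesis .
qed

lemma b_less: "b < w"
proof -
  have "2 ^ b * 1 \<le> 2 ^ b * (c * d * 2 ^ n)" using c_pos d_pos by (intro mult_le_mono) auto
  then have "2 ^ b \<le> N" by (simp add: N_def mult.commute)
  then have "(2 :: nat) ^ b < 2 ^ w" using N_less by (rule le_less_trans)
  then show ?thesis by (rule power_less_imp_less_exp[rotated]) simp
qed

lemma g_pos: "g > 0" using b_less by (simp add: g_def b_def div_greater_zero_iff)

lemma d_le_g_L: "d \<le> g * L"
proof -
  have "d - 1 < ((d - 1) div g + 1) * g" using dividend_less_div_times[of g "d - 1"] g_pos by simp
  then show ?thesis by (simp add: L_def mult.commute)
qed

lemma field_word_less: "j < d \<Longrightarrow> j div g < L"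
  using d_le_g_L g_pos by (simp add: div_less_iff_less_mult mult.commute)

lemma W_ge: "L \<le> W" by (simp add: W_def)

lemma table_end: "A + W \<le> 16 * W"
  using W_ge L_pos by (simp add: A_def)

section \<open>Positions of the table fields\<close>

definition entry :: "nat \<Rightarrow> nat \<Rightarrow> nat \<Rightarrow> nat \<Rightarrow> nat" where
  "entry i k x v = ((i * d + k) * 2 ^ n + x) * 2 ^ b + v"

lemma entry_less:
  "i < c \<Longrightarrow> k < d \<Longrightarrow> x < 2 ^ n \<Longrightarrow> v < 2 ^ b \<Longrightarrow> entry i k x v < N"
  unfolding entry_def N_def by (intro mixed_radix_less)

lemma entry_inj:
  assumes "entry i k x v = entry i' k' x' v'" "k < d" "x < 2 ^ n" "v < 2 ^ b"
    "k' < d" "x' < 2 ^ n" "v' < 2 ^ b"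
  shows "i = i' \<and> k = k' \<and> x = x' \<and> v = v'"
proof -
  have 1: "(i * d + k) * 2 ^ n + x = (i' * d + k') * 2 ^ n + x' \<and> v = v'"
    using assms unfolding entry_def by (intro mixed_radix_inj)
  then have 2: "i * d + k = i' * d + k' \<and> x = x'" using assms by (intro mixed_radix_inj) auto
  then have "i = i' \<and> k = k'" using assms by (intro mixed_radix_inj) auto
  with 1 2 show ?thesis by simp
qed

lemma entry_address_less: "e < N \<Longrightarrow> q < L \<Longrightarrow> e div P * L + A + q < A + W"
proof -
  assume "e < N" "q < L"
  then have "e div P * L + q < (N div P + 1) * L"
    by (intro mixed_radix_less) (auto simp: less_Suc_eq_le div_le_mono)
  then show ?thesis by (simp add: W_def)
qed

text \<open>Word and bit offset of field \<open>j\<close> of entry \<open>e\<close>, in one formula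
  for both packings: \<open>e mod P = 0\<close> if \<open>P = 1\<close>, and
  \<open>j div g = 0\<close> for \<open>j < d\<close> if \<open>d \<le> g\<close>.\<close>

definition addr :: "nat \<Rightarrow> nat \<Rightarrow> nat" where "addr e j = e div P * L + A + j div g"
definition shift :: "nat \<Rightarrow> nat \<Rightarrow> nat" where "shift e j = (e mod P) * (d * b) + (j mod g) * b"

lemma shift_le: "j < d \<Longrightarrow> shift e j + b \<le> w"
proof (cases "P = 1")
  case True
  have "(j mod g + 1) * b \<le> g * b" using g_pos by (intro mult_le_mono) (auto simp: Suc_le_eq)
  then show ?thesis using True g_b_le by (simp add: shift_def)
next
  case False
  assume j: "j < d"
  from False P_L_cases have "d \<le> g" "P * d \<le> g" by auto
  have "e mod P * d + j < P * d" using P_pos j by (intro mixed_radix_less) auto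
  then have "(e mod P * d + j + 1) * b \<le> g * b" using \<open>P * d \<le> g\<close> by (intro mult_le_mono) auto
  then show ?thesis using g_b_le j \<open>d \<le> g\<close> by (simp add: shift_def algebra_simps)
qed

text \<open>In each of the two packings one part of the position is trivial, and the other is a
  mixed radix representation. This disjointness of fields is what makes them independent random
  numbers.\<close>

lemma position_inj:
  assumes "addr e j = addr e' j'" "shift e j + l = shift e' j' + l'"
    "j < d" "j' < d" "l < b" "l' < b"
  shows "e = e' \<and> j = j' \<and> l = l'"
proof (cases "P = 1")
  case True
  then have "e * L + j div g = e' * L + j' div g" using assms(1) by (simp add: addr_def)
  then have e: "e = e'" "j div g = j' div g"
    using mixed_radix_inj field_word_less assms(3,4) by blast+
  have "j mod g * b + l = j' mod g * b + l'" using assms(2) True by (simp add: shift_def)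
  then have "j mod g = j' mod g" "l = l'" using mixed_radix_inj assms(5,6) by blast+
  then show ?thesis using e div_mod_decomp[of j g] div_mod_decomp[of j' g] by metis
next
  case False
  with P_L_cases have L: "L = 1" "d \<le> g" by auto
  then have jg: "j div g = 0" "j' div g = 0" "j mod g = j" "j' mod g = j'" using assms(3,4) by auto
  have e: "e div P = e' div P" using assms(1) by (simp add: addr_def L jg)
  have "(e mod P * d + j) * b + l = (e' mod P * d + j') * b + l'"
    using assms(2) by (simp add: shift_def jg algebra_simps)
  then have "e mod P * d + j = e' mod P * d + j'" "l = l'" using mixed_radix_inj assms(5,6) by blast+
  moreover from this have "e mod P = e' mod P" "j = j'" using mixed_radix_inj assms(3,4) by blast+
  ultimately show ?thesis using e div_mod_decomp[of e P] div_mod_decomp[of e' P] by metis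
qed

text \<open>The tables are indexed by the input position, which counts down as the recursion goes up.\<close>

definition tab :: "(nat \<Rightarrow> nat) \<Rightarrow> nat \<Rightarrow> nat \<Rightarrow> nat \<Rightarrow> nat \<Rightarrow> nat \<Rightarrow> nat" where
  "tab f i k x v j = (let e = entry (c - 1 - i) k x v in f (addr e j) div 2 ^ shift e j mod 2 ^ b)"

definition contents :: "(nat \<Rightarrow> nat) set" where
  "contents = PiE_dflt {A..<A + W} 0 (\<lambda>_. {..<2 ^ w})"

lemma drop_take_mod: "x div 2 ^ s mod 2 ^ b = take_bit b (drop_bit s x)" for x :: nat
  by (simp add: drop_bit_eq_div take_bit_eq_mod)

text \<open>Justifies both the xor of whole words in place of single fields and the translation of
  the tables by word-wise xor.\<close>

lemma field_xor:
  "(x XOR y) div 2 ^ s mod 2 ^ b = (x div 2 ^ s mod 2 ^ b) XOR (y div 2 ^ s mod 2 ^ b)" for x y :: nat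
  unfolding drop_take_mod by simp

text \<open>By \<open>position_inj\<close> and \<open>entry_inj\<close>, each bit of a word is
  prescribed by at most one field, so the existential in \<open>bits\<close> is unambiguous; bits
  outside all fields are 0.\<close>

lemma offset_exists:
  assumes D: "\<And>i k x v j. D i k x v j < (2 ^ b :: nat)"
  shows "\<exists>E. (\<forall>a. E a < 2 ^ w) \<and> (\<forall>i<c. \<forall>k<d. \<forall>x<2 ^ n. \<forall>v<2 ^ b. \<forall>j<d. tab E i k x v j = D i k x v j)"
proof -
  define bits where "bits a m \<longleftrightarrow> (\<exists>i k x v j l. i < c \<and> k < d \<and> x < 2 ^ n \<and> v < 2 ^ b \<and> j < d \<and> l < b \<and>
      a = addr (entry (c - 1 - i) k x v) j \<and> m = shift (entry (c - 1 - i) k x v) j + l \<and>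
      bit (D i k x v j) l)" for a m
  define E :: "nat \<Rightarrow> nat" where "E a = horner_sum of_bool 2 (map (bits a) [0..<w])" for a
  have bitE: "bit (E a) m \<longleftrightarrow> m < w \<and> bits a m" for a m
    unfolding E_def bit_horner_sum_bit_iff by auto
  have "E a < 2 ^ w" for a
  proof -
    have "take_bit w (E a) = E a" by (rule bit_eqI) (auto simp: bit_take_bit_iff bitE)
    then show ?thesis by (simp add: take_bit_nat_eq_self_iff)
  qed
  moreover have "tab E i k x v j = D i k x v j"
    if r: "i < c" "k < d" "x < 2 ^ n" "v < 2 ^ b" "j < d" for i k x v j
  proof -
    define e where "e = entry (c - 1 - i) k x v"
    have "bits (addr e j) (shift e j + l) \<longleftrightarrow> bit (D i k x v j) l" if l: "l < b" for l
    proof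
      assume "bits (addr e j) (shift e j + l)"
      then obtain i' k' x' v' j' l' where *: "i' < c" "k' < d" "x' < 2 ^ n" "v' < 2 ^ b" "j' < d" "l' < b"
        "addr e j = addr (entry (c - 1 - i') k' x' v') j'"
        "shift e j + l = shift (entry (c - 1 - i') k' x' v') j' + l'"
        "bit (D i' k' x' v' j') l'"
        unfolding bits_def by blast
      from position_inj[OF *(7,8) r(5) *(5) l *(6)]
      have eq: "e = entry (c - 1 - i') k' x' v'" "j = j'" "l = l'" by auto
      from entry_inj[OF eq(1)[unfolded e_def] r(2-4) *(2-4)]
      have "c - 1 - i = c - 1 - i'" "k = k'" "x = x'" "v = v'" by auto
      moreover from this(1) have "i = i'" using r(1) *(1) by linarith
      ultimately show "bit (D i k x v j) l" using *(9) eq by simp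
    next
      assume "bit (D i k x v j) l"
      then show "bits (addr e j) (shift e j + l)" unfolding bits_def e_def using r l by blast
    qed
    moreover have "shift e j + l < w" if "l < b" for l using shift_le[OF r(5), of e] that by simp
    ultimately have "take_bit b (drop_bit (shift e j) (E (addr e j))) = take_bit b (D i k x v j)"
      by (intro bit_eqI) (auto simp: bit_take_bit_iff bit_drop_bit_eq bitE)
    also have "\<dots> = D i k x v j" using D by (simp add: take_bit_nat_eq_self)
    finally show ?thesis unfolding tab_def Let_def drop_take_mod e_def .
  qed
  ultimately show ?thesis by blast
qed

lemma random_tables: "random_tables contents tab c n \<kappa> b d"
proof
  show "finite contents" unfolding contents_def by (intro finite_PiE_dflt) auto
  show "c > 0" "n > 0" by (rule c_pos n_pos)+
  show "b = n + \<kappa> + 1" "d = 4 * c" by (simp_all add: b_def d_def)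
  show "tab M i k x v j < 2 ^ b" for M i k x v j by (simp add: tab_def Let_def)
next
  fix D :: "nat \<Rightarrow> nat \<Rightarrow> nat \<Rightarrow> nat \<Rightarrow> nat \<Rightarrow> nat"
  assume D: "\<And>i k x v j. D i k x v j < 2 ^ b"
  obtain E where E: "\<And>a. E a < 2 ^ w"
    "\<And>i k x v j. i < c \<Longrightarrow> k < d \<Longrightarrow> x < 2 ^ n \<Longrightarrow> v < 2 ^ b \<Longrightarrow> j < d \<Longrightarrow> tab E i k x v j = D i k x v j"
    using offset_exists[of D, OF D] by metis
  \<comment> \<open>Words outside the table stay at the default 0, so that the result lies in
    \<open>contents\<close>.\<close>
  define \<phi> where "\<phi> f a = (if a \<in> {A..<A + W} then f a XOR E a else 0)" for f a
  have "inj_on \<phi> contents"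
  proof (rule inj_onI, rule ext)
    fix f f' a assume f: "f \<in> contents" "f' \<in> contents" "\<phi> f = \<phi> f'"
    show "f a = f' a"
    proof (cases "a \<in> {A..<A + W}")
      case True
      have "f a XOR E a = f' a XOR E a" using f(3) True by (simp add: \<phi>_def fun_eq_iff split: if_splits)
      then have "(f a XOR E a) XOR E a = (f' a XOR E a) XOR E a" by simp
      then show ?thesis by (simp add: xor.assoc)
    next
      case False
      then show ?thesis using f by (simp add: contents_def PiE_dflt_def)
    qed
  qed
  moreover have "\<phi> ` contents \<subseteq> contents"
    by (auto simp: contents_def PiE_dflt_def \<phi>_def intro!: xor_less_power E(1))
  moreover have "tab (\<phi> f) i k x v j = tab f i k x v j XOR D i k x v j"
    if r: "i < c" "k < d" "x < 2 ^ n" "v < 2 ^ b" "j < d" for f i k x v j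
  proof -
    define e where "e = entry (c - 1 - i) k x v"
    have "e < N" unfolding e_def using r by (intro entry_less) auto
    then have "addr e j \<in> {A..<A + W}"
      using entry_address_less[of e "j div g"] field_word_less[OF r(5)] by (auto simp: addr_def)
    then have "tab (\<phi> f) i k x v j = tab f i k x v j XOR tab E i k x v j"
      unfolding tab_def Let_def e_def[symmetric] by (simp add: \<phi>_def field_xor)
    then show ?thesis using E(2) r by simp
  qed
  ultimately show "\<exists>\<phi>. inj_on \<phi> contents \<and> \<phi> ` contents \<subseteq> contents \<and>
      (\<forall>M\<in>contents. \<forall>i<c. \<forall>k<d. \<forall>x<2 ^ n. \<forall>v<2 ^ b. \<forall>j<d.
        tab (\<phi> M) i k x v j = tab M i k x v j XOR D i k x v j)"
    by blast
qed

end

section \<open>The programs\<close>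

text \<open>
  Registers: 0 and 1 hold these constants, 2 to 4 the parameters, 5 to 13 the constants of the
  layout. During a query, 15 and 16 are the source and target buffers and 18 is the sum of the two
  writable buffer addresses; 17, 20, 22 count input positions, words and fields down, 19 is the
  current input word and 21 accumulates an output word.
\<close>

definition setup_code :: "instr list" where
  "setup_code = [Const 1 1, Binop Add 5 3 4, Binop Add 5 5 1, Const 6 4, Binop Mul 6 6 2, Word_Size 7,
     Binop Div 8 7 5, Binop Div 9 8 6, Binop Eq 14 9 0, Binop Add 9 9 14,
     Binop Sub 10 6 1, Binop Div 10 10 8, Binop Add 10 10 1,
     Const 14 3, Binop Mul 11 14 10, Binop Add 11 11 14, Binop Shl 12 1 5, Binop Mul 13 6 5]"

text \<open>Only the memory survives until a query, so the parameters are stored and each query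
  recomputes the layout constants from them.\<close>

definition init_com :: com where
  "init_com =
     (Do [Const 1 1, Input 2 0, Input 3 1, Const 14 2, Input 4 14, Store 0 2, Store 1 3, Store 14 4] ;;
     Do setup_code ;;
     Do [Binop Mul 15 2 6, Binop Shl 15 15 3, Binop Shl 15 15 5, Binop Div 15 15 9,
       Binop Add 15 15 1, Binop Mul 22 15 10]) ;;
     fill_random"

definition fetch_code :: "instr list" where
  "fetch_code = [Binop Sub 22 22 1, Binop Div 23 22 8, Binop Add 23 15 23, Load 23 23,
     Binop Mod 24 22 8, Binop Mul 24 24 5, Binop Shr 23 23 24, Binop Mod 23 23 12]"

text \<open>The word is shifted but not masked, so bits of later entries in the same word may enter
  the accumulator. They stay above the \<open>d\<close> fields, where nothing reads them, and xor
  produces no carries.\<close>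

definition lookup_code :: "instr list" where
  "lookup_code = [Binop Mul 24 17 6, Binop Add 24 24 22, Binop Shl 24 24 3, Binop Add 24 24 19,
     Binop Shl 24 24 5, Binop Add 24 24 23, Binop Div 25 24 9, Binop Mul 25 25 10,
     Binop Add 25 25 11, Binop Add 25 25 20, Load 25 25, Binop Mod 24 24 9, Binop Mul 24 24 13,
     Binop Shr 25 25 24, Binop Xor 21 21 25]"

definition word_com :: com where
  "word_com =
     Do [Binop Sub 20 20 1, Const 21 0, Binop Add 22 0 6] ;;
     Loop 22 (Do (fetch_code @ lookup_code)) ;;
     Do [Binop Add 23 16 20, Store 23 21]"

definition level_com :: com where
  "level_com =
     Do [Binop Sub 17 17 1, Input 19 17, Binop Add 20 0 10] ;;
     Loop 20 word_com ;;
     Do [Binop Add 15 16 0, Binop Sub 16 18 16]"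

definition query_com :: com where
  "query_com =
     Do [Const 1 1, Load 2 0, Load 3 1, Const 14 2, Load 4 14] ;;
     Do setup_code ;;
     Do [Const 15 3, Binop Add 16 15 10, Binop Add 17 0 2, Binop Add 18 11 15] ;;
     Loop 17 level_com ;;
     Do [Binop Add 22 0 6] ;;
     Loop 22 (Do (fetch_code @ [Output 22 23]))"

lemma wp_append: "wp w sp inp (xs @ ys) Q R M Z = wp w sp inp xs (wp w sp inp ys Q) R M Z"
proof (induction xs arbitrary: R M Z)
  case (Cons i xs)
  then show ?case by (cases i) (simp_all del: fun_upd_apply)
qed simp

lemma wp_mono:
  "wp w sp inp ins Q R M Z \<Longrightarrow> (\<And>R M Z. Q R M Z \<Longrightarrow> Q' R M Z) \<Longrightarrow> wp w sp inp ins Q' R M Z"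
proof (induction ins arbitrary: R M Z)
  case (Cons i ins)
  then show ?case by (cases i) (auto simp del: fun_upd_apply)
qed simp

section \<open>Correctness and running time of a query\<close>

context layout
begin

definition constants :: "(nat \<Rightarrow> nat) \<Rightarrow> bool" where
  "constants R \<longleftrightarrow> R 0 = 0 \<and> R 1 = 1 \<and> R 2 = c \<and> R 3 = n \<and> R 5 = b \<and> R 6 = d \<and> R 8 = g \<and> R 9 = P \<and>
     R 10 = L \<and> R 11 = A \<and> R 12 = 2 ^ b \<and> R 13 = d * b"

lemma le_N_less: "x \<le> N \<Longrightarrow> x < 2 ^ w"
  using N_less by linarith

lemma mult_le_N: "x \<le> c * d \<Longrightarrow> y \<le> 2 ^ n \<Longrightarrow> z \<le> 2 ^ b \<Longrightarrow> x * y * z \<le> N"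
  unfolding N_def by (intro mult_le_mono)

text \<open>Most of these quantities are bounded by \<open>N\<close> or by \<open>w\<close>; those
  built from \<open>L\<close> use \<open>16 * W \<le> 2 ^ w\<close>.\<close>

lemma bounds:
  shows "c < 2 ^ w" "n < 2 ^ w" "\<kappa> < 2 ^ w" "n + \<kappa> < 2 ^ w" "b < 2 ^ w" "d < 2 ^ w" "g < 2 ^ w" "P < 2 ^ w"
    "L < 2 ^ w" "3 * L < 2 ^ w" "A < 2 ^ w" "A + 3 < 2 ^ w" "3 < (2 :: nat) ^ w" "4 < (2 :: nat) ^ w"
    "(2 :: nat) ^ b < 2 ^ w" "d * b < 2 ^ w" "w < 2 ^ w" "16 * W \<le> 2 ^ w"
proof -
  have c1: "1 \<le> c" using c_pos by simp
  have d4: "4 \<le> d" using c_pos by (simp add: d_def)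
  have cd: "c \<le> c * d" "d \<le> c * d" using c_pos d_pos by auto
  show "c < 2 ^ w" using mult_le_N[of c 1 1] cd by (intro le_N_less) auto
  show d: "d < 2 ^ w" using mult_le_N[of d 1 1] cd by (intro le_N_less) auto
  show "4 < (2 :: nat) ^ w"
  proof -
    have "4 * 1 * 2 \<le> N" using order_trans[OF d4 cd(2)] by (intro mult_le_N) (auto simp: b_def)
    then show ?thesis by (intro le_N_less) simp
  qed
  then show "3 < (2 :: nat) ^ w" by simp
  have b: "b < 2 ^ b" by (rule less_exp)
  show db: "d * b < 2 ^ w" using mult_le_N[of d 1 b] cd b by (intro le_N_less) auto
  show "(2 :: nat) ^ b < 2 ^ w" using b_less by simp
  then show bw: "b < 2 ^ w" using b by linarith
  then show "n < 2 ^ w" "\<kappa> < 2 ^ w" "n + \<kappa> < 2 ^ w" by (auto simp: b_def)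
  show w: "w < 2 ^ w" by (rule less_exp)
  have "g \<le> w" by (simp add: g_def)
  then show "g < 2 ^ w" using w by linarith
  have "P \<le> w"
  proof (cases "P = 1")
    case False
    then have "P * d \<le> g" using P_L_cases by auto
    moreover have "P * 1 \<le> P * d" using d_pos by (intro mult_le_mono) auto
    ultimately show ?thesis using \<open>g \<le> w\<close> by linarith
  qed (use w_pos in simp)
  then show "P < 2 ^ w" using w by linarith
  show "16 * W \<le> 2 ^ w" by (rule fits)
  then have "16 * L \<le> 2 ^ w" using W_ge by linarith
  then show "L < 2 ^ w" "3 * L < 2 ^ w" "A < 2 ^ w" "A + 3 < 2 ^ w" using L_pos by (auto simp: A_def)
qed

lemma wp_setup:
  assumes "R 0 = 0" "R 2 = c" "R 3 = n" "R 4 = \<kappa>"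
  shows "wp w sp inp setup_code (\<lambda>R' M' Z'. constants R' \<and> M' = M \<and> Z' = Z) R M Z"
proof -
  have eqs: "Suc (n + \<kappa>) = b" "4 * c = d" "w div b = g" "g div d + of_bool (g div d = 0) = P"
    "Suc ((d - Suc 0) div g) = L" "3 * L + 3 = A"
    by (simp_all add: b_def d_def g_def P_def L_def A_def)
  have "g div d < 2 ^ w" using bounds by (meson div_le_dividend order.strict_trans1)
  moreover have "d - Suc 0 < 2 ^ w" "(d - Suc 0) div g < 2 ^ w"
    using bounds by (meson div_le_dividend diff_le_self order.strict_trans1)+
  moreover have "of_bool Q < (2 :: nat) ^ w" for Q using bounds(13) by simp
  moreover have "Suc 0 < 2 ^ w" using bounds(13) by linarith
  moreover have "Suc 0 \<le> d" using d_pos by simp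
  ultimately show ?thesis
    unfolding setup_code_def using assms bounds
    by (simp add: eqs constants_def)
qed

lemma wp_fetch:
  assumes R: "constants R" "R 22 = Suc j" "j < d" "R 15 + L \<le> A" and M: "\<And>a. M a < 2 ^ w"
    and Q: "Q (R(22 := j, 24 := j mod g * b,
      23 := M (R 15 + j div g) div 2 ^ (j mod g * b) mod 2 ^ b)) M Z"
  shows "wp w (16 * W) inp fetch_code Q R M Z"
proof -
  define a where "a = R 15 + j div g"
  have a: "a < 16 * W" using field_word_less[OF R(3)] R(4) table_end by (simp add: a_def)
  then have aw: "a < 2 ^ w" using bounds by linarith
  have jw: "j < 2 ^ w" using R(3) bounds by linarith
  then have jg: "j div g < 2 ^ w" "j mod g < 2 ^ w"
    by (meson div_le_dividend mod_less_eq_dividend order.strict_trans1)+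
  have "j mod g * b < g * b" using g_pos by (intro mult_strict_right_mono) (auto simp: b_def)
  then have jb: "j mod g * b < 2 ^ w" using g_b_le bounds by linarith
  have m: "M a div 2 ^ (j mod g * b) < 2 ^ w" "M a div 2 ^ (j mod g * b) mod 2 ^ b < 2 ^ w"
    using M[of a] by (meson div_le_dividend mod_less_eq_dividend order.strict_trans1)+
  define y z where "y = j mod g * b" and "z = M a div 2 ^ y mod 2 ^ b"
  have upd: "R(22 := j, 23 := z, 24 := y) = R(22 := j, 24 := y, 23 := z)"
    by (auto simp: fun_eq_iff)
  have Q': "Q (R(22 := j, 23 := z, 24 := y)) M Z"
    unfolding upd using Q by (simp only: a_def y_def z_def)
  show ?thesis
    unfolding fetch_code_def using R(1,2) Q' a aw jw jg jb m M
    by (simp add: constants_def a_def[symmetric] y_def[symmetric] z_def[symmetric] fun_upd_twist)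
qed

lemma wp_lookup:
  assumes R: "constants R" "R 17 = i" "i < c" "R 22 = k" "k < d" "R 19 = x" "x < 2 ^ n"
      "R 23 = v" "v < 2 ^ b" "R 20 = q" "q < L" "R 21 < 2 ^ w"
    and M: "\<And>a. M a < 2 ^ w"
    and Q: "\<And>y z. Q (R(24 := y, 25 := z, 21 := R 21 XOR
      (M (entry i k x v div P * L + A + q) div 2 ^ (entry i k x v mod P * (d * b))))) M Z"
  shows "wp w (16 * W) inp lookup_code Q R M Z"
proof -
  define e where "e = entry i k x v"
  have e: "e < N" unfolding e_def using R by (intro entry_less)
  then have ew: "e < 2 ^ w" using N_less by simp
  define a where "a = e div P * L + A + q"
  have "a < A + W" unfolding a_def using e R by (intro entry_address_less)
  then have a: "a < 16 * W" using table_end by linarith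
  have aw: "a < 2 ^ w" using a bounds by linarith
  \<comment> \<open>The intermediate results of the Horner evaluation of \<open>entry\<close>
    increase up to \<open>e < N\<close>, so none of them overflows.\<close>
  define u1 u2 u3 u4 u5 where "u1 = i * d" and "u2 = u1 + k" and "u3 = u2 * 2 ^ n"
    and "u4 = u3 + x" and "u5 = u4 * 2 ^ b"
  have ee: "u5 + v = e" by (simp add: e_def entry_def u1_def u2_def u3_def u4_def u5_def)
  have "u1 \<le> u2" "u2 \<le> u3" "u3 \<le> u4" "u4 \<le> u5" "u5 \<le> e"
    by (simp_all add: u2_def u3_def u4_def u5_def ee[symmetric])
  then have u: "u1 < 2 ^ w" "u2 < 2 ^ w" "u3 < 2 ^ w" "u4 < 2 ^ w" "u5 < 2 ^ w" using ew by linarith+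
  define y where "y = e mod P * (d * b)"
  have y: "y < 2 ^ w"
  proof -
    have "y \<le> shift e 0" by (simp add: y_def shift_def)
    also have "\<dots> \<le> w" using shift_le[of 0 e] d_pos by simp
    finally show ?thesis using bounds by linarith
  qed
  define a1 a2 where "a1 = e div P * L" and "a2 = a1 + A"
  have aa: "a2 + q = a" by (simp add: a_def a1_def a2_def)
  then have a12: "a1 < 2 ^ w" "a2 < 2 ^ w" using aw by (simp_all add: a2_def)
  have em: "e div P < 2 ^ w" "e mod P < 2 ^ w"
    using ew by (meson div_le_dividend mod_less_eq_dividend order.strict_trans1)+
  define z where "z = M a div 2 ^ y"
  have z: "z < 2 ^ w"
    unfolding z_def using M[of a] by (meson div_le_dividend order.strict_trans1)
  then have x: "R 21 XOR z < 2 ^ w" using R by (intro xor_less_power)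
  have Q': "Q (R(24 := y, 25 := z, 21 := R 21 XOR z)) M Z"
    using Q[of y z] unfolding e_def[symmetric] a_def[symmetric] y_def[symmetric] z_def[symmetric] .
  note folds = u1_def[symmetric] u2_def[symmetric] u3_def[symmetric] u4_def[symmetric] u5_def[symmetric]
    ee y_def[symmetric] a1_def[symmetric] a2_def[symmetric] aa z_def[symmetric]
  show ?thesis
    unfolding lookup_code_def using R Q' a aw ew u y a12 em z x M
    by (simp add: constants_def folds fun_upd_twist)
qed

text \<open>The two writable buffers are constrained by the word size only. A query may leave any
  words there, which lets this predicate survive every query.\<close>

definition mem_ok :: "(nat \<Rightarrow> nat) \<Rightarrow> (nat \<Rightarrow> nat) \<Rightarrow> bool" where
  "mem_ok f M \<longleftrightarrow> M 0 = c \<and> M 1 = n \<and> M 2 = \<kappa> \<and> (\<forall>a. 3 \<le> a \<and> a < 3 + L \<longrightarrow> M a = 0) \<and>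
     (\<forall>a. A \<le> a \<and> a < A + W \<longrightarrow> M a = f a) \<and> (\<forall>a. M a < 2 ^ w)"

lemma mem_ok_update:
  "mem_ok f M \<Longrightarrow> 3 + L \<le> a \<Longrightarrow> a < A \<Longrightarrow> v < 2 ^ w \<Longrightarrow> mem_ok f (M(a := v))"
  by (auto simp: mem_ok_def)

text \<open>A summand of a word takes 23 instructions and 2 steps of loop overhead. The 30 collects
  the straight-line code outside all loops and the last tests of the two outermost loops.\<close>

definition query_time :: nat where
  "query_time = c * (L * (25 * d + 8) + 8) + 11 * d + 30"

end

locale query = layout +
  fixes f :: "nat \<Rightarrow> nat" and X :: "nat list"
  assumes length_X: "length X = c" and X_less: "set X \<subseteq> {..<2 ^ n}"
begin

abbreviation "\<gamma> \<equiv> tower d (tab f)"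

definition buffer :: "(nat \<Rightarrow> nat) \<Rightarrow> nat \<Rightarrow> nat list \<Rightarrow> bool" where
  "buffer M src xs \<longleftrightarrow> (\<forall>j<d. M (src + j div g) div 2 ^ (j mod g * b) mod 2 ^ b = \<gamma> xs j)"

text \<open>A whole word of an entry, with its fields side by side and, as in
  \<open>lookup_code\<close>, without a mask.\<close>

definition contribution :: "nat \<Rightarrow> nat \<Rightarrow> nat \<Rightarrow> nat" where
  "contribution i q k = (let e = entry i k (X ! i) (\<gamma> (drop (Suc i) X) k) in
     f (e div P * L + A + q) div 2 ^ (e mod P * (d * b)))"

text \<open>The first level reads the zero buffer; afterwards the two writable buffers swap roles.
  \<open>A + 3\<close> is the sum of their addresses, so subtracting one of them gives the
  other.\<close>

definition ready :: "(nat \<Rightarrow> nat) \<Rightarrow> (nat \<Rightarrow> nat) \<Rightarrow> bool" where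
  "ready R M \<longleftrightarrow> constants R \<and> mem_ok f M \<and> R 18 = A + 3 \<and>
     (R 15, R 16) \<in> {(3, 3 + L), (3 + L, 3 + 2 * L), (3 + 2 * L, 3 + L)}"

definition levels_left :: "nat \<Rightarrow> (nat \<Rightarrow> nat) \<Rightarrow> (nat \<Rightarrow> nat) \<Rightarrow> (nat \<Rightarrow> nat) \<Rightarrow> bool" where
  "levels_left i R M Z \<longleftrightarrow> ready R M \<and> R 17 = i \<and> buffer M (R 15) (drop i X)"

text \<open>Target words from index \<open>done\<close> on are finished. The counter is decremented
  before its word is computed and stored, so \<open>done\<close> is \<open>q\<close> between words
  and \<open>Suc q\<close> while word \<open>q\<close> is under way.\<close>

definition at_level :: "nat \<Rightarrow> nat \<Rightarrow> nat \<Rightarrow> (nat \<Rightarrow> nat) \<Rightarrow> (nat \<Rightarrow> nat) \<Rightarrow> bool" where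
  "at_level i q done R M \<longleftrightarrow> ready R M \<and> R 17 = i \<and> R 19 = X ! i \<and> R 20 = q \<and>
     buffer M (R 15) (drop (Suc i) X) \<and>
     (\<forall>q'. done \<le> q' \<and> q' < L \<longrightarrow> M (R 16 + q') = xor_sum (contribution i q') d)"

definition words_left :: "nat \<Rightarrow> nat \<Rightarrow> (nat \<Rightarrow> nat) \<Rightarrow> (nat \<Rightarrow> nat) \<Rightarrow> (nat \<Rightarrow> nat) \<Rightarrow> bool" where
  "words_left i q R M Z \<longleftrightarrow> at_level i q q R M"

text \<open>As \<open>k\<close> counts down, the accumulator holds the contributions from
  \<open>k\<close> upwards; the equation expresses this through the initial part of the sum.\<close>

definition fields_left :: "nat \<Rightarrow> nat \<Rightarrow> nat \<Rightarrow> (nat \<Rightarrow> nat) \<Rightarrow> (nat \<Rightarrow> nat) \<Rightarrow> (nat \<Rightarrow> nat) \<Rightarrow> bool" where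
  "fields_left i q k R M Z \<longleftrightarrow> at_level i q (Suc q) R M \<and> R 22 = k \<and> R 21 < 2 ^ w \<and>
     R 21 XOR xor_sum (contribution i q) k = xor_sum (contribution i q) d"

definition outputs_left :: "nat \<Rightarrow> (nat \<Rightarrow> nat) \<Rightarrow> (nat \<Rightarrow> nat) \<Rightarrow> (nat \<Rightarrow> nat) \<Rightarrow> bool" where
  "outputs_left k R M Z \<longleftrightarrow> ready R M \<and> R 22 = k \<and> buffer M (R 15) X \<and>
     (\<forall>j. k \<le> j \<and> j < d \<longrightarrow> Z j = \<gamma> X j)"

lemma gamma_less: "\<gamma> xs j < 2 ^ b"
  by (rule tower_less) (simp add: tab_def Let_def)

lemma X_nth_less: "i < c \<Longrightarrow> X ! i < 2 ^ n"
  using X_less length_X nth_mem by fastforce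

lemma ready_mem: "ready R M \<Longrightarrow> M a < 2 ^ w"
  by (simp add: ready_def mem_ok_def)

lemma ready_source: "ready R M \<Longrightarrow> R 15 + L \<le> A"
  by (auto simp: ready_def A_def)

lemma triple_field:
  assumes i: "i < c" and q: "q < L" and k: "k < d"
  shows "triple w (16 * W) X (fields_left i q (Suc k)) (Do (fetch_code @ lookup_code)) 23 (fields_left i q k)"
proof -
  have pre: "wp w (16 * W) X (fetch_code @ lookup_code) (fields_left i q k) R M Z"
    if inv: "fields_left i q (Suc k) R M Z" for R M Z
  proof -
    let ?v = "\<gamma> (drop (Suc i) X) k"
    have lev: "at_level i q (Suc q) R M" and r: "ready R M" "constants R" and R22: "R 22 = Suc k"
      and Rs: "R 17 = i" "R 19 = X ! i" "R 20 = q" "R 21 < 2 ^ w"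
      and acc: "R 21 XOR xor_sum (contribution i q) (Suc k) = xor_sum (contribution i q) d"
      using inv by (auto simp: fields_left_def at_level_def ready_def)
    have v: "M (R 15 + k div g) div 2 ^ (k mod g * b) mod 2 ^ b = ?v"
      using lev k by (auto simp: at_level_def buffer_def)
    define e where "e = entry i k (X ! i) ?v"
    have "e < N" unfolding e_def using i k X_nth_less gamma_less by (intro entry_less)
    then have "e div P * L + A + q < A + W" using q by (rule entry_address_less)
    then have Mf: "M (e div P * L + A + q) = f (e div P * L + A + q)"
      using r by (auto simp: ready_def mem_ok_def)
    define u where "u = contribution i q k"
    have u: "M (e div P * L + A + q) div 2 ^ (e mod P * (d * b)) = u"
      unfolding Mf by (simp add: u_def contribution_def e_def Let_def)
    have "u < 2 ^ w" unfolding u[symmetric] using ready_mem[OF r(1)]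
      by (meson div_le_dividend order.strict_trans1)
    then have uw: "R 21 XOR u < 2 ^ w" using Rs by (intro xor_less_power)
    have acc': "(R 21 XOR u) XOR xor_sum (contribution i q) k = xor_sum (contribution i q) d"
      using acc by (simp add: u_def xor.assoc xor.commute[of "contribution i q k"])
    define R' where "R' = R(22 := k, 24 := k mod g * b, 23 := ?v)"
    have "wp w (16 * W) X lookup_code (fields_left i q k) R' M Z"
    proof (rule wp_lookup[where i = i and k = k and x = "X ! i" and v = ?v and q = q])
      show "constants R'" using r by (simp add: R'_def constants_def)
      show "R' 17 = i" "R' 22 = k" "R' 19 = X ! i" "R' 23 = ?v" "R' 20 = q" "R' 21 < 2 ^ w"
        using Rs by (simp_all add: R'_def)
      show "fields_left i q k (R'(24 := y, 25 := z, 21 := R' 21 XOR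
          (M (entry i k (X ! i) ?v div P * L + A + q) div 2 ^ (entry i k (X ! i) ?v mod P * (d * b))))) M Z" for y z
        unfolding e_def[symmetric] u using inv Rs uw acc'
        by (simp add: fields_left_def at_level_def ready_def constants_def R'_def)
    qed (use i k q X_nth_less gamma_less ready_mem[OF r(1)] in auto)
    then show ?thesis
      unfolding wp_append using r R22 k ready_source ready_mem v
      by (intro wp_fetch[where j = k]) (auto simp: R'_def)
  qed
  show ?thesis by (rule triple_Do, erule pre, simp add: fetch_code_def lookup_code_def)
qed

lemma triple_word:
  assumes i: "i < c" and q: "q < L"
  shows "triple w (16 * W) X (words_left i (Suc q)) word_com (25 * d + 6) (words_left i q)"
proof -
  have pre: "wp w (16 * W) X [Binop Sub 20 20 1, Const 21 0, Binop Add 22 0 6] (fields_left i q d) R M Z"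
    if "words_left i (Suc q) R M Z" for R M Z
  proof -
    have "q < 2 ^ w" using q bounds by linarith
    then show ?thesis
      using that bounds
      by (simp add: words_left_def fields_left_def at_level_def ready_def constants_def)
  qed
  have 1: "triple w (16 * W) X (words_left i (Suc q))
      (Do [Binop Sub 20 20 1, Const 21 0, Binop Add 22 0 6]) 3 (fields_left i q d)" by (rule triple_Do, erule pre, simp)
  have 2: "triple w (16 * W) X (fields_left i q d) (Loop 22 (Do (fetch_code @ lookup_code)))
      (d * (23 + 2) + 1) (fields_left i q 0)"
    by (rule triple_Loop, simp add: fields_left_def, erule triple_field[OF i q])
  have pre: "wp w (16 * W) X [Binop Add 23 16 20, Store 23 21] (words_left i q) R M Z"
    if inv: "fields_left i q 0 R M Z" for R M Z
  proof -
    let ?a = "R 16 + q"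
    have lev: "at_level i q (Suc q) R M" and r: "ready R M" and R20: "R 20 = q"
      and acc: "R 21 = xor_sum (contribution i q) d" "R 21 < 2 ^ w"
      using inv by (auto simp: fields_left_def at_level_def)
    have a: "3 + L \<le> ?a" "?a < A" using r q by (auto simp: ready_def A_def)
    then have aw: "?a < 2 ^ w" "?a < 16 * W" using bounds table_end by linarith+
    \<comment> \<open>Source and target are different buffers of \<open>L\<close> words, so the
      store leaves the source intact for the remaining words.\<close>
    have src: "R 15 + j div g \<noteq> ?a" if "j < d" for j
      using r q field_word_less[OF that] by (auto simp: ready_def)
    have ok: "mem_ok f (M(?a := R 21))"
      using r a acc(2) by (intro mem_ok_update) (auto simp: ready_def)
    have buf: "buffer (M(?a := R 21)) (R 15) (drop (Suc i) X)"
      using lev src by (auto simp: at_level_def buffer_def)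
    have "words_left i q (R(23 := ?a)) (M(?a := R 21)) Z"
      unfolding words_left_def at_level_def
    proof (intro conjI allI impI)
      show "ready (R(23 := ?a)) (M(?a := R 21))"
        using r ok by (simp add: ready_def constants_def)
      show "buffer (M(?a := R 21)) ((R(23 := ?a)) 15) (drop (Suc i) X)" using buf by simp
      fix q' assume q': "q \<le> q' \<and> q' < L"
      show "(M(?a := R 21)) ((R(23 := ?a)) 16 + q') = xor_sum (contribution i q') d"
      proof (cases "q' = q")
        case True
        then show ?thesis using acc by simp
      next
        case False
        then show ?thesis using lev q' by (simp add: at_level_def)
      qed
    qed (use lev in \<open>auto simp: at_level_def\<close>)
    then show ?thesis using aw R20 by simp
  qed
  have 3: "triple w (16 * W) X (fields_left i q 0)
      (Do [Binop Add 23 16 20, Store 23 21]) 2 (words_left i q)" by (rule triple_Do, erule pre, simp)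
  show ?thesis
    unfolding word_com_def by (rule triple_mono[OF triple_Seq[OF 1 triple_Seq[OF 2 3]]]) simp
qed

text \<open>Field extraction commutes with xor, and the offset of an entry in its word plus that of
  the field in the entry is \<open>shift e j\<close>. So each field of the summed words is the sum
  of table fields that defines \<open>tower\<close>.\<close>

lemma buffer_level:
  assumes i: "i < c" and M: "\<And>q. q < L \<Longrightarrow> M (a + q) = xor_sum (contribution i q) d"
  shows "buffer M a (drop i X)"
  unfolding buffer_def
proof (intro allI impI)
  fix j assume j: "j < d"
  let ?xs = "drop (Suc i) X"
  have field: "xor_sum h m div 2 ^ s mod 2 ^ b = xor_sum (\<lambda>k. h k div 2 ^ s mod 2 ^ b) m" for h m s
    by (induction m) (simp_all add: field_xor)
  have drop: "drop i X = X ! i # ?xs" using i length_X by (simp add: Cons_nth_drop_Suc)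
  have len: "c - 1 - length ?xs = i" using i length_X by simp
  have "M (a + j div g) div 2 ^ (j mod g * b) mod 2 ^ b =
      xor_sum (\<lambda>k. contribution i (j div g) k div 2 ^ (j mod g * b) mod 2 ^ b) d"
    by (simp add: M field_word_less[OF j] field)
  also have "\<dots> = xor_sum (\<lambda>k. tab f (length ?xs) k (X ! i) (\<gamma> ?xs k) j) d"
    unfolding tab_def len contribution_def Let_def addr_def shift_def
    by (simp add: div_mult2_eq[symmetric] power_add[symmetric])
  also have "\<dots> = \<gamma> (drop i X) j" unfolding drop by simp
  finally show "M (a + j div g) div 2 ^ (j mod g * b) mod 2 ^ b = \<gamma> (drop i X) j" .
qed

lemma triple_level:
  assumes i: "i < c"
  shows "triple w (16 * W) X (levels_left (Suc i)) level_com (L * (25 * d + 8) + 6) (levels_left i)"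
proof -
  have pre: "wp w (16 * W) X [Binop Sub 17 17 1, Input 19 17, Binop Add 20 0 10] (words_left i L) R M Z"
    if "levels_left (Suc i) R M Z" for R M Z
  proof -
    have "i < 2 ^ w" using i bounds by linarith
    moreover have "X ! i < 2 ^ w"
      using X_nth_less[OF i] bounds(2) b_less
      by (rule_tac order.strict_trans[of _ "2 ^ n"]) (auto simp: b_def)
    ultimately show ?thesis
      using that bounds i length_X
      by (simp add: words_left_def levels_left_def at_level_def ready_def constants_def)
  qed
  have 1: "triple w (16 * W) X (levels_left (Suc i))
      (Do [Binop Sub 17 17 1, Input 19 17, Binop Add 20 0 10]) 3 (words_left i L)" by (rule triple_Do, erule pre, simp)
  have 2: "triple w (16 * W) X (words_left i L) (Loop 20 word_com) (L * (25 * d + 6 + 2) + 1) (words_left i 0)"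
    by (rule triple_Loop, simp add: words_left_def at_level_def, erule triple_word[OF i])
  have pre: "wp w (16 * W) X [Binop Add 15 16 0, Binop Sub 16 18 16] (levels_left i) R M Z"
    if inv: "words_left i 0 R M Z" for R M Z
  proof -
    have r: "ready R M" and R17: "R 17 = i"
      and M: "\<And>q. q < L \<Longrightarrow> M (R 16 + q) = xor_sum (contribution i q) d"
      using inv by (auto simp: words_left_def at_level_def)
    have buf: "buffer M (R 16) (drop i X)" using i M by (rule buffer_level)
    have "R 16 + L \<le> A" "R 18 = A + 3" using r by (auto simp: ready_def A_def)
    then have w: "R 16 < 2 ^ w" "R 18 - R 16 < 2 ^ w" "R 16 \<le> R 18" using bounds by linarith+
    have "ready (R(15 := R 16, 16 := R 18 - R 16)) M"
      using r by (auto simp: ready_def constants_def A_def)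
    then have "levels_left i (R(15 := R 16, 16 := R 18 - R 16)) M Z"
      using R17 buf by (simp add: levels_left_def)
    moreover have "R 0 = 0" using r by (simp add: ready_def constants_def)
    ultimately show ?thesis using w by simp
  qed
  have 3: "triple w (16 * W) X (words_left i 0)
      (Do [Binop Add 15 16 0, Binop Sub 16 18 16]) 2 (levels_left i)" by (rule triple_Do, erule pre, simp)
  show ?thesis
    unfolding level_com_def by (rule triple_mono[OF triple_Seq[OF 1 triple_Seq[OF 2 3]]]) simp
qed

lemma triple_output:
  assumes k: "k < d"
  shows "triple w (16 * W) X (outputs_left (Suc k)) (Do (fetch_code @ [Output 22 23])) 9 (outputs_left k)"
proof -
  have pre: "wp w (16 * W) X (fetch_code @ [Output 22 23]) (outputs_left k) R M Z"
    if inv: "outputs_left (Suc k) R M Z" for R M Z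
  proof -
    have r: "ready R M" "constants R" and R22: "R 22 = Suc k" and buf: "buffer M (R 15) X"
      using inv by (auto simp: outputs_left_def ready_def)
    have v: "M (R 15 + k div g) div 2 ^ (k mod g * b) mod 2 ^ b = \<gamma> X k"
      using buf k by (auto simp: buffer_def)
    have "outputs_left k (R(22 := k, 24 := k mod g * b, 23 := \<gamma> X k)) M (Z(k := \<gamma> X k))"
      using inv by (auto simp: outputs_left_def ready_def constants_def)
    then show ?thesis
      unfolding wp_append using r R22 k ready_source ready_mem
      by (intro wp_fetch[where j = k]) (auto simp: v)
  qed
  show ?thesis by (rule triple_Do, erule pre, simp add: fetch_code_def)
qed

lemma triple_query:
  "triple w (16 * W) X (\<lambda>R M Z. R = (\<lambda>_. 0) \<and> mem_ok f M) query_com query_time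
     (\<lambda>R M Z. mem_ok f M \<and> (\<forall>j<d. Z j = \<gamma> X j))"
proof -
  have s2: "2 < (2 :: nat) ^ w" "Suc 0 < 2 ^ w" using bounds(13) by linarith+
  have sp: "3 < 16 * W" using W_ge L_pos by linarith
  have pre: "wp w (16 * W) X [Const 1 1, Load 2 0, Load 3 1, Const 14 2, Load 4 14]
     (\<lambda>R M Z. R 0 = 0 \<and> R 2 = c \<and> R 3 = n \<and> R 4 = \<kappa> \<and> mem_ok f M) R M Z"
    if "R = (\<lambda>_. 0) \<and> mem_ok f M" for R M Z
    using that sp s2 bounds by (auto simp: mem_ok_def)
  have 1: "triple w (16 * W) X (\<lambda>R M Z. R = (\<lambda>_. 0) \<and> mem_ok f M)
     (Do [Const 1 1, Load 2 0, Load 3 1, Const 14 2, Load 4 14]) 5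
     (\<lambda>R M Z. R 0 = 0 \<and> R 2 = c \<and> R 3 = n \<and> R 4 = \<kappa> \<and> mem_ok f M)" by (rule triple_Do, erule pre, simp)
  have pre: "wp w (16 * W) X setup_code (\<lambda>R M Z. constants R \<and> mem_ok f M) R M Z"
    if "R 0 = 0 \<and> R 2 = c \<and> R 3 = n \<and> R 4 = \<kappa> \<and> mem_ok f M" for R M Z
    using that by (intro wp_mono[OF wp_setup]) auto
  have 2: "triple w (16 * W) X
     (\<lambda>R M Z. R 0 = 0 \<and> R 2 = c \<and> R 3 = n \<and> R 4 = \<kappa> \<and> mem_ok f M)
     (Do setup_code) 18 (\<lambda>R M Z. constants R \<and> mem_ok f M)" by (rule triple_Do, erule pre, simp add: setup_code_def)
  have pre: "wp w (16 * W) X [Const 15 3, Binop Add 16 15 10, Binop Add 17 0 2, Binop Add 18 11 15]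
     (levels_left c) R M Z"
    if ok: "constants R \<and> mem_ok f M" for R M Z
  proof -
    \<comment> \<open>The zero buffer represents \<open>tower\<close> at the empty key.\<close>
    have "buffer M 3 []" using ok field_word_less by (auto simp: buffer_def mem_ok_def)
    moreover have "3 + L < 2 ^ w" using bounds by (simp add: A_def)
    ultimately show ?thesis
      using ok bounds length_X by (simp add: levels_left_def ready_def constants_def)
  qed
  have 3: "triple w (16 * W) X (\<lambda>R M Z. constants R \<and> mem_ok f M)
     (Do [Const 15 3, Binop Add 16 15 10, Binop Add 17 0 2, Binop Add 18 11 15]) 4 (levels_left c)"
    by (rule triple_Do, erule pre, simp)
  have 4: "triple w (16 * W) X (levels_left c) (Loop 17 level_com)
     (c * (L * (25 * d + 8) + 6 + 2) + 1) (levels_left 0)"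
    by (rule triple_Loop, simp add: levels_left_def, erule triple_level)
  have pre: "wp w (16 * W) X [Binop Add 22 0 6] (outputs_left d) R M Z" if "levels_left 0 R M Z" for R M Z
    using that bounds by (simp add: levels_left_def outputs_left_def ready_def constants_def)
  have 5: "triple w (16 * W) X (levels_left 0) (Do [Binop Add 22 0 6]) 1 (outputs_left d)"
    by (rule triple_Do, erule pre, simp)
  have 6: "triple w (16 * W) X (outputs_left d) (Loop 22 (Do (fetch_code @ [Output 22 23])))
     (d * (9 + 2) + 1) (outputs_left 0)"
    by (rule triple_Loop, simp add: outputs_left_def, erule triple_output)
  have "triple w (16 * W) X (\<lambda>R M Z. R = (\<lambda>_. 0) \<and> mem_ok f M) query_com query_time (outputs_left 0)"
    unfolding query_com_def query_time_def
    by (rule triple_mono[OF triple_Seq[OF 1 triple_Seq[OF 2 triple_Seq[OF 3 triple_Seq[OF 4 triple_Seq[OF 5 6]]]]]]) simp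
  then show ?thesis
    unfolding triple_def outputs_left_def ready_def by fastforce
qed

end

section \<open>From numbers back to bit strings\<close>

lemma bits_to_nat_less: "bits_to_nat x < 2 ^ length x"
proof -
  have "take_bit (length x) (bits_to_nat x) = bits_to_nat x"
    unfolding bits_to_nat_def by (rule bit_eqI) (auto simp: bit_take_bit_iff bit_horner_sum_bit_iff)
  then show ?thesis by (simp add: take_bit_nat_eq_self_iff)
qed

lemma bits_to_nat_inj:
  assumes "length x = length y" "bits_to_nat x = bits_to_nat y"
  shows "x = y"
proof (rule nth_equalityI[OF assms(1)])
  fix i assume "i < length x"
  moreover have "bit (bits_to_nat x) i = bit (bits_to_nat y) i" using assms(2) by simp
  ultimately show "x ! i = y ! i" using assms(1) by (simp add: bits_to_nat_def bit_horner_sum_bit_iff)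
qed

lemma vectors_to_words: "x \<in> vectors c n \<Longrightarrow> map bits_to_nat x \<in> words n c"
  using bits_to_nat_less by (fastforce simp: vectors_def words_def)

lemma vectors_to_words_inj: "inj_on (map bits_to_nat) (vectors c n)"
proof (rule inj_onI)
  fix x y assume x: "x \<in> vectors c n" and y: "y \<in> vectors c n" and eq: "map bits_to_nat x = map bits_to_nat y"
  show "x = y"
  proof (rule nth_equalityI)
    show len: "length x = length y" using eq by (rule map_eq_imp_length_eq)
    fix i assume i: "i < length x"
    then have "bits_to_nat (x ! i) = bits_to_nat (y ! i)" using eq len by (metis nth_map)
    moreover have "length (x ! i) = length (y ! i)" using x y i len by (simp add: vectors_def)
    ultimately show "x ! i = y ! i" using bits_to_nat_inj by blast
  qed
qed

lemma finite_vectors: "finite (vectors c n)"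
  using finite_imageD[OF _ vectors_to_words_inj] finite_subset[OF _ finite_words] vectors_to_words
  by (metis image_subsetI)

definition bit_function :: "nat \<Rightarrow> nat \<Rightarrow> (nat list \<Rightarrow> nat \<Rightarrow> nat) \<Rightarrow> bool list list \<Rightarrow> bool list list" where
  "bit_function d b \<gamma> x = map (\<lambda>j. map (bit (\<gamma> (map bits_to_nat x) j)) [0..<b]) [0..<d]"

lemma bit_function_mem: "bit_function d b \<gamma> x \<in> vectors d b"
  by (auto simp: bit_function_def vectors_def)

lemma bits_to_nat_bit_function:
  "j < d \<Longrightarrow> \<gamma> (map bits_to_nat x) j < 2 ^ b \<Longrightarrow>
    bits_to_nat (bit_function d b \<gamma> x ! j) = \<gamma> (map bits_to_nat x) j"
  by (simp add: bit_function_def bits_to_nat_def horner_sum_bit_eq_take_bit take_bit_nat_eq_self)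

text \<open>Both encodings, of keys and of values, are injective in the relevant range, so a value
  taken only once becomes a neighbour owned by one key.\<close>

lemma k_unique_bit_function:
  assumes "unique_upto n c d k \<gamma>" and less: "\<And>xs j. \<gamma> xs j < 2 ^ b"
  shows "k_unique c n d k (bit_function d b \<gamma>)"
  unfolding k_unique_def
proof (intro allI impI)
  let ?\<Gamma> = "bit_function d b \<gamma>"
  fix S assume S: "S \<subseteq> vectors c n" and ne: "S \<noteq> {} \<and> card S \<le> k"
  have fin: "finite S" using S finite_vectors finite_subset by blast
  have "map bits_to_nat ` S \<subseteq> words n c" using S vectors_to_words by blast
  moreover have "card (map bits_to_nat ` S) \<le> k" using card_image_le[OF fin, of "map bits_to_nat"] ne by simp
  ultimately have "uniquely_coloured d \<gamma> (map bits_to_nat ` S)"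
    using assms(1) ne unfolding unique_upto_def by blast
  then obtain x j where x: "x \<in> S" and j: "j < d"
    and sep: "\<And>y. y \<in> map bits_to_nat ` S - {map bits_to_nat x} \<Longrightarrow> \<gamma> y j \<noteq> \<gamma> (map bits_to_nat x) j"
    unfolding uniquely_coloured_def by blast
  \<comment> \<open>\<open>neighbours\<close> numbers the components from 1, lists from 0.\<close>
  have "(Suc j, ?\<Gamma> x ! j) \<in> neighbours d ?\<Gamma> {x}"
    using j by (auto simp: neighbours_def intro!: exI[of _ "Suc j"])
  moreover have "(Suc j, ?\<Gamma> x ! j) \<notin> neighbours d ?\<Gamma> (S - {x})"
  proof
    assume "(Suc j, ?\<Gamma> x ! j) \<in> neighbours d ?\<Gamma> (S - {x})"
    then obtain y where y: "y \<in> S" "y \<noteq> x" "?\<Gamma> x ! j = ?\<Gamma> y ! j" by (auto simp: neighbours_def)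
    then have "bits_to_nat (?\<Gamma> x ! j) = bits_to_nat (?\<Gamma> y ! j)" by simp
    then have "\<gamma> (map bits_to_nat x) j = \<gamma> (map bits_to_nat y) j"
      by (simp add: bits_to_nat_bit_function j less)
    moreover have "map bits_to_nat y \<noteq> map bits_to_nat x"
      using inj_onD[OF vectors_to_words_inj] x y S by blast
    ultimately show False using sep[of "map bits_to_nat y"] y(1) by auto
  qed
  \<comment> \<open>Finiteness is essential, since the cardinality of an infinite set is 0.\<close>
  moreover have "finite (neighbours d ?\<Gamma> {x})"
  proof -
    have "neighbours d ?\<Gamma> {x} = (\<lambda>i. (i, ?\<Gamma> x ! (i - 1))) ` {1..d}" by (auto simp: neighbours_def)
    then show ?thesis by simp
  qed
  ultimately show "\<exists>x\<in>S. card (neighbours d ?\<Gamma> {x} - neighbours d ?\<Gamma> (S - {x})) > 0"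
    using x by (intro bexI[OF _ x]) (auto simp: card_gt_0_iff)
qed

lemma executes_Seq_return:
  assumes "executes w sp inp c1 \<sigma> s (return_pmf \<sigma>')" "executes w sp inp c2 \<sigma>' t \<mu>"
  shows "executes w sp inp (c1 ;; c2) \<sigma> (s + t) \<mu>"
  using executes_Seq[OF assms(1), of c2 t "\<lambda>_. \<mu>"] assms(2) by (simp add: bind_return_pmf)

lemma executes_run:
  assumes "executes w sp inp c ((\<lambda>_. 0), M, (\<lambda>_. 0)) t \<mu>"
  shows "run w sp (code 0 c) inp t (start M) = map_pmf (at_pc (code_size c)) \<mu>"
  using assms[unfolded executes_def, rule_format, of "[]" "[]"] by (simp add: start_def)

section \<open>Assembling the data structure\<close>

context layout
begin

definition initial_mem :: "(nat \<Rightarrow> nat) \<Rightarrow> nat \<Rightarrow> nat" where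
  "initial_mem f a = (if a \<in> {A..<A + W} then f a else ((\<lambda>_. 0)(0 := c, 1 := n, 2 := \<kappa>)) a)"

lemma mem_ok_initial: "f \<in> contents \<Longrightarrow> mem_ok f (initial_mem f)"
  using bounds(1-3) by (auto simp: mem_ok_def initial_mem_def contents_def PiE_dflt_def A_def)

text \<open>The deterministic prefix ends in a single configuration; after it, independent uniform
  words make the table region uniform on \<open>contents\<close>.\<close>

lemma executes_init:
  "\<exists>T \<mu>. executes w (16 * W) [c, n, \<kappa>] init_com ((\<lambda>_. 0), (\<lambda>_. 0), (\<lambda>_. 0)) T \<mu> \<and>
     map_pmf (\<lambda>\<sigma>. fst (snd \<sigma>)) \<mu> = map_pmf initial_mem (pmf_of_set contents)"
proof -
  let ?M = "(\<lambda>_. 0 :: nat)(0 := c, 1 := n, 2 := \<kappa>)"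
  let ?P1 = "\<lambda>R M Z. R 0 = 0 \<and> R 2 = c \<and> R 3 = n \<and> R 4 = \<kappa> \<and> M = ?M"
  let ?P2 = "\<lambda>R M Z. constants R \<and> M = ?M"
  let ?P3 = "\<lambda>R M Z. R 0 = 0 \<and> R 1 = 1 \<and> R 11 = A \<and> R 22 = W \<and> M = ?M"
  have s2: "2 < (2 :: nat) ^ w" "Suc 0 < 2 ^ w" using bounds(13) by linarith+
  have sp: "3 < 16 * W" using W_ge L_pos by linarith
  have Ww: "W < 2 ^ w" using sp bounds(18) by linarith
  have pre: "wp w (16 * W) [c, n, \<kappa>]
      [Const 1 1, Input 2 0, Input 3 1, Const 14 2, Input 4 14, Store 0 2, Store 1 3, Store 14 4] ?P1 R M Z"
    if "R = (\<lambda>_. 0) \<and> M = (\<lambda>_. 0)" for R M Z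
    using that s2 sp bounds by (auto simp: fun_eq_iff)
  have 1: "triple w (16 * W) [c, n, \<kappa>] (\<lambda>R M Z. R = (\<lambda>_. 0) \<and> M = (\<lambda>_. 0))
    (Do [Const 1 1, Input 2 0, Input 3 1, Const 14 2, Input 4 14, Store 0 2, Store 1 3, Store 14 4]) 8 ?P1"
    by (rule triple_Do, erule pre, simp)
  have pre: "wp w (16 * W) [c, n, \<kappa>] setup_code ?P2 R M Z" if "?P1 R M Z" for R M Z
    by (rule wp_mono[OF wp_setup]) (use that in auto)
  have 2: "triple w (16 * W) [c, n, \<kappa>] ?P1 (Do setup_code) 18 ?P2"
    by (rule triple_Do, erule pre, simp add: setup_code_def)
  have pre: "wp w (16 * W) [c, n, \<kappa>] [Binop Mul 15 2 6, Binop Shl 15 15 3, Binop Shl 15 15 5, Binop Div 15 15 9,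
       Binop Add 15 15 1, Binop Mul 22 15 10] ?P3 R M Z" if "?P2 R M Z" for R M Z
  proof -
    have N: "c * d * 2 ^ n * 2 ^ b = N" and W': "Suc (N div P) * L = W" by (simp_all add: N_def W_def)
    have "c * d * 1 * 1 \<le> N" "c * d * 2 ^ n * 1 \<le> N" by (intro mult_le_N; simp)+
    then have "c * d < 2 ^ w" "c * d * 2 ^ n < 2 ^ w" using N_less by linarith+
    moreover have "Suc (N div P) * 1 \<le> Suc (N div P) * L" using L_pos by (intro mult_le_mono) auto
    then have "Suc (N div P) \<le> W" unfolding W' mult_1_right .
    then have "Suc (N div P) < 2 ^ w" using Ww by linarith
    moreover from this have "N div P < 2 ^ w" by linarith
    ultimately show ?thesis
      using that N_less Ww by (simp add: constants_def N W' del: mult_Suc)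
  qed
  have 3: "triple w (16 * W) [c, n, \<kappa>] ?P2 (Do [Binop Mul 15 2 6, Binop Shl 15 15 3, Binop Shl 15 15 5,
       Binop Div 15 15 9, Binop Add 15 15 1, Binop Mul 22 15 10]) 6 ?P3"
    by (rule triple_Do, erule pre, simp)
  from triple_Seq[OF 1 triple_Seq[OF 2 3]] obtain s R Z where
    ex: "executes w (16 * W) [c, n, \<kappa>]
      (Do [Const 1 1, Input 2 0, Input 3 1, Const 14 2, Input 4 14, Store 0 2, Store 1 3, Store 14 4] ;;
       Do setup_code ;; Do [Binop Mul 15 2 6, Binop Shl 15 15 3, Binop Shl 15 15 5,
       Binop Div 15 15 9, Binop Add 15 15 1, Binop Mul 22 15 10])
      ((\<lambda>_. 0), (\<lambda>_. 0), (\<lambda>_. 0)) s (return_pmf (R, ?M, Z))"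
    and R: "R 0 = 0" "R 1 = 1" "R 11 = A" "R 22 = W"
    unfolding triple_def by blast
  obtain \<mu> where \<mu>: "executes w (16 * W) [c, n, \<kappa>] fill_random (R, ?M, Z) (W * 6 + 1) \<mu>"
    "map_pmf (\<lambda>\<sigma>. fst (snd \<sigma>)) \<mu> = map_pmf (\<lambda>f a. if a \<in> {A..<A + W} then f a else ?M a)
        (Pi_pmf {A..<A + W} 0 (\<lambda>_. pmf_of_set {..<2 ^ w}))"
    using executes_fill_random[OF R table_end bounds(18) Ww] by blast
  have "Pi_pmf {A..<A + W} 0 (\<lambda>_. pmf_of_set {..<2 ^ w}) = pmf_of_set contents"
    unfolding contents_def by (intro Pi_pmf_of_set) (auto simp: lessThan_empty_iff)
  then have "map_pmf (\<lambda>\<sigma>. fst (snd \<sigma>)) \<mu> = map_pmf initial_mem (pmf_of_set contents)"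
    using \<mu>(2) unfolding initial_mem_def by simp
  moreover have "executes w (16 * W) [c, n, \<kappa>] init_com ((\<lambda>_. 0), (\<lambda>_. 0), (\<lambda>_. 0)) (s + (W * 6 + 1)) \<mu>"
    unfolding init_com_def by (rule executes_Seq_return[OF ex \<mu>(1)])
  ultimately show ?thesis by blast
qed

definition represented :: "(nat \<Rightarrow> nat) \<Rightarrow> bool list list \<Rightarrow> bool list list" where
  "represented f = bit_function d b (tower d (tab f))"

text \<open>The coinduction invariant is \<open>mem_ok f\<close>, which each query restores;
  \<open>represented f\<close> depends on \<open>f\<close> alone, however the buffers
  change.\<close>

lemma evaluates_represented:
  assumes "mem_ok f M" "real query_time \<le> \<tau>"
  shows "evaluates w (16 * W) (code 0 query_com) c n d \<tau> (represented f) M"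
  using assms(1)
proof (coinduction arbitrary: M rule: evaluates.coinduct)
  case evaluates
  have "\<exists>t. real t \<le> \<tau> \<and>
      (\<forall>s\<in>set_pmf (run w (16 * W) (code 0 query_com) (map bits_to_nat x) t (start M)).
         halted (code 0 query_com) s \<and> (\<forall>i<d. outp s i = bits_to_nat (represented f x ! i)) \<and> mem_ok f (mem s))"
    if x: "x \<in> vectors c n" for x
  proof -
    have "map bits_to_nat x \<in> words n c" using x by (rule vectors_to_words)
    then interpret query c n \<kappa> w f "map bits_to_nat x"
      by unfold_locales (auto simp: words_def)
    obtain t R' M' Z' where t: "t \<le> query_time"
      and ex: "executes w (16 * W) (map bits_to_nat x) query_com ((\<lambda>_. 0), M, (\<lambda>_. 0)) t (return_pmf (R', M', Z'))"
      and post: "mem_ok f M'" "\<forall>j<d. Z' j = \<gamma> (map bits_to_nat x) j"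
      using triple_query evaluates unfolding triple_def by blast
    have "bits_to_nat (represented f x ! j) = \<gamma> (map bits_to_nat x) j" if "j < d" for j
      unfolding represented_def by (rule bits_to_nat_bit_function[OF that gamma_less])
    moreover have "real t \<le> \<tau>" using t assms(2) by linarith
    ultimately show ?thesis
      using post by (intro exI[of _ t]) (simp add: executes_run[OF ex] halted_def)
  qed
  then show ?case by blast
qed

lemma query_time_bound:
  "real query_time \<le> 10000 * (real c ^ 2 + real c ^ 3 * real (n + \<kappa>) / real w)"
proof -
  \<comment> \<open>190 = 100 + 8 + 52 + 30, as \<open>c * L\<close>, \<open>c\<close> and 1 are at
    most \<open>c * c * L\<close>. The 100 is 25 steps per summand times the 4 of
    \<open>d = 4 * c\<close>.\<close>
  have "query_time \<le> 190 * (c * c * L)"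
  proof -
    have "c * 1 * 1 \<le> c * c * L" "1 * 1 * 1 \<le> c * c * L" "1 * c * L \<le> c * c * L"
      using c_pos L_pos by (intro mult_le_mono; simp add: Suc_le_eq)+
    moreover have "query_time = 100 * (c * c * L) + 8 * (c * L) + 52 * c + 30"
      by (simp add: query_time_def d_def algebra_simps)
    ultimately show ?thesis unfolding mult_1 mult_1_right by linarith
  qed
  then have "real query_time \<le> real (190 * (c * c * L))" by (rule of_nat_mono)
  also have "\<dots> = 190 * real c ^ 2 * real L" by (simp add: power2_eq_square)
  also have "\<dots> \<le> 190 * real c ^ 2 * (1 + 16 * (c * (n + \<kappa>)) / w)"
  proof (rule mult_left_mono)
    have "real L \<le> 1 + 2 * d * b / w" using b_less by (intro words_per_entry_bound) simp
    also have "2 * d * b \<le> 16 * (c * (n + \<kappa>))" using n_pos by (simp add: d_def b_def)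
    then have "real (2 * d * b) / w \<le> real (16 * (c * (n + \<kappa>))) / w"
      by (intro divide_right_mono of_nat_mono) auto
    finally show "real L \<le> 1 + 16 * (c * (n + \<kappa>)) / w" by simp
  qed simp
  also have "\<dots> = 190 * real c ^ 2 + 3040 * (real c ^ 3 * real (n + \<kappa>) / real w)"
    by (simp add: distrib_left power2_eq_square power3_eq_cube)
  also have "\<dots> \<le> 10000 * (real c ^ 2 + real c ^ 3 * real (n + \<kappa>) / real w)"
    unfolding distrib_left by (intro add_mono mult_right_mono) auto
  finally show ?thesis .
qed

end

theorem theorem9p6:
  "\<exists>(init :: program) (query :: program) (space :: nat \<Rightarrow> nat \<Rightarrow> nat \<Rightarrow> nat \<Rightarrow> nat) (C :: real).
     \<forall>c n \<kappa> w :: nat. c > 0 \<and> n > 0 \<and> \<kappa> > 0 \<and> w > 0 \<longrightarrow>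
       real (space c n \<kappa> w) \<le> C * of_int \<lceil>2 ^ (2 * n + \<kappa>) * real c ^ 3 * real (n + \<kappa>) / real w\<rceil> \<and>
       (space c n \<kappa> w \<le> 2 ^ w \<longrightarrow>
         (let \<tau> = C * (real c ^ 2 + real c ^ 3 * real (n + \<kappa>) / real w);
              implements = (\<lambda>\<Gamma> s. \<Gamma> \<in> vectors c n \<rightarrow> vectors (4 * c) (n + \<kappa> + 1) \<and>
                 evaluates w (space c n \<kappa> w) query c n (4 * c) \<tau> \<Gamma> (mem s))
          in \<exists>T. let D = run w (space c n \<kappa> w) init [c, n, \<kappa>] T (start (\<lambda>_. 0))
             in (\<forall>s\<in>set_pmf D. halted init s \<and> (\<exists>\<Gamma>. implements \<Gamma> s)) \<and>
                measure_pmf.prob D {s. \<exists>\<Gamma>. implements \<Gamma> s \<and> k_unique c n (4 * c) (2 ^ \<kappa>) \<Gamma>}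
                  \<ge> 1 - 1 / 2 ^ (c * n)))"
proof (rule exI[of _ "code 0 init_com"], rule exI[of _ "code 0 query_com"],
    rule exI[of _ "\<lambda>c n \<kappa> w. 16 * params.W c n \<kappa> w"], rule exI[of _ "10000"], intro allI impI)
  fix c n \<kappa> w :: nat
  assume pos: "c > 0 \<and> n > 0 \<and> \<kappa> > 0 \<and> w > 0"
  then interpret params c n \<kappa> w by unfold_locales auto
  \<comment> \<open>The constant 10000 covers 16 * 512 = 8192 for the space and 190 * 16 = 3040 for
    the time.\<close>
  define \<tau> where "\<tau> = 10000 * (real c ^ 2 + real c ^ 3 * real (n + \<kappa>) / real w)"
  define implements where "implements \<Gamma> s \<longleftrightarrow> \<Gamma> \<in> vectors c n \<rightarrow> vectors (4 * c) (n + \<kappa> + 1) \<and>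
    evaluates w (16 * W) (code 0 query_com) c n (4 * c) \<tau> \<Gamma> (mem s)" for \<Gamma> and s :: state
  have "\<exists>T. let D = run w (16 * W) (code 0 init_com) [c, n, \<kappa>] T (start (\<lambda>_. 0))
     in (\<forall>s\<in>set_pmf D. halted (code 0 init_com) s \<and> (\<exists>\<Gamma>. implements \<Gamma> s)) \<and>
        measure_pmf.prob D {s. \<exists>\<Gamma>. implements \<Gamma> s \<and> k_unique c n (4 * c) (2 ^ \<kappa>) \<Gamma>}
          \<ge> 1 - 1 / 2 ^ (c * n)" if fits: "16 * W \<le> 2 ^ w"
  proof -
    interpret layout c n \<kappa> w by unfold_locales (rule fits)
    interpret random_tables contents tab c n \<kappa> b d by (rule random_tables)
    obtain T \<mu> where ex: "executes w (16 * W) [c, n, \<kappa>] init_com ((\<lambda>_. 0), (\<lambda>_. 0), (\<lambda>_. 0)) T \<mu>"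
      and \<mu>: "map_pmf (\<lambda>\<sigma>. fst (snd \<sigma>)) \<mu> = map_pmf initial_mem (pmf_of_set contents)"
      using executes_init by blast
    define D where "D = map_pmf (at_pc (code_size init_com)) \<mu>"
    have run: "run w (16 * W) (code 0 init_com) [c, n, \<kappa>] T (start (\<lambda>_. 0)) = D"
      unfolding D_def by (rule executes_run[OF ex])
    have mem_D: "map_pmf mem D = map_pmf initial_mem (pmf_of_set contents)"
      unfolding \<mu>[symmetric] D_def by (simp add: pmf.map_comp o_def)
    have ne: "contents \<noteq> {}" unfolding contents_def by (auto simp: lessThan_empty_iff)
    have set: "set_pmf (pmf_of_set contents) = contents" using ne finite_Omega by (rule set_pmf_of_set)
    have impl: "implements (represented f) s" if "f \<in> contents" "mem s = initial_mem f" for f s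
    proof -
      have "represented f \<in> vectors c n \<rightarrow> vectors d b"
        unfolding represented_def by (intro funcsetI bit_function_mem)
      moreover have "evaluates w (16 * W) (code 0 query_com) c n d \<tau> (represented f) (mem s)"
        unfolding that(2) \<tau>_def
        by (rule evaluates_represented[OF mem_ok_initial[OF that(1)] query_time_bound])
      ultimately show ?thesis unfolding implements_def d_eq b_eq by blast
    qed
    have "halted (code 0 init_com) s \<and> (\<exists>\<Gamma>. implements \<Gamma> s)" if s: "s \<in> set_pmf D" for s
    proof
      show "halted (code 0 init_com) s" using s by (auto simp: D_def halted_def)
      have "mem s \<in> set_pmf (map_pmf mem D)" using s by simp
      then obtain f where "f \<in> contents" "mem s = initial_mem f" unfolding mem_D by (auto simp: set)
      then show "\<exists>\<Gamma>. implements \<Gamma> s" using impl by blast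
    qed
    moreover have "1 - 1 / 2 ^ (c * n) \<le>
      measure_pmf.prob D {s. \<exists>\<Gamma>. implements \<Gamma> s \<and> k_unique c n (4 * c) (2 ^ \<kappa>) \<Gamma>}"
    proof -
      let ?U = "unique_at c"
      have U: "?U \<subseteq> contents" by (auto simp: unique_at_def)
      have card: "card contents > 0" using ne finite_Omega by (simp add: card_gt_0_iff)
      have "real (card (contents - ?U)) = real (card contents) - real (card ?U)"
        using card_Diff_subset[OF finite_subset[OF U finite_Omega] U] card_mono[OF finite_Omega U] by simp
      then have "real (card contents) * (1 - 1 / 2 ^ (c * n)) \<le> real (card ?U)"
        using card_not_unique by (simp add: right_diff_distrib)
      then have "1 - 1 / 2 ^ (c * n) \<le> real (card ?U) / real (card contents)"
        using card by (simp add: pos_le_divide_eq mult.commute)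
      also have "\<dots> = measure_pmf.prob (pmf_of_set contents) ?U"
        using ne finite_Omega U by (simp add: measure_pmf_of_set Int_absorb1)
      \<comment> \<open>The distribution of the final state is known through its memory only, so the
        event is first turned into a set of memories, the image of \<open>?U\<close> under
        \<open>initial_mem\<close>.\<close>
      also have "\<dots> \<le> measure_pmf.prob (pmf_of_set contents) (initial_mem -` (initial_mem ` ?U))"
        by (intro measure_pmf.finite_measure_mono) auto
      also have "\<dots> = measure_pmf.prob (map_pmf mem D) (initial_mem ` ?U)"
        unfolding mem_D by simp
      also have "\<dots> = measure_pmf.prob D (mem -` (initial_mem ` ?U))" by simp
      also have "\<dots> \<le> measure_pmf.prob D {s. \<exists>\<Gamma>. implements \<Gamma> s \<and> k_unique c n (4 * c) (2 ^ \<kappa>) \<Gamma>}"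
      proof (rule measure_pmf.finite_measure_mono)
        show "mem -` (initial_mem ` ?U) \<subseteq>
          {s. \<exists>\<Gamma>. implements \<Gamma> s \<and> k_unique c n (4 * c) (2 ^ \<kappa>) \<Gamma>}"
        proof
          fix s :: state assume "s \<in> mem -` (initial_mem ` ?U)"
          then obtain f where f: "f \<in> ?U" "mem s = initial_mem f" by blast
          then have "k_unique c n d (2 ^ \<kappa>) (represented f)"
            unfolding represented_def unique_at_def by (intro k_unique_bit_function gamma_less) auto
          then show "s \<in> {s. \<exists>\<Gamma>. implements \<Gamma> s \<and> k_unique c n (4 * c) (2 ^ \<kappa>) \<Gamma>}"
            using impl f U d_eq by auto
        qed
      qed simp
      finally show ?thesis .
    qed
    ultimately show ?thesis unfolding Let_def by (intro exI[of _ T]) (simp add: run)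
  qed
  then show "real (16 * W) \<le> 10000 * of_int \<lceil>2 ^ (2 * n + \<kappa>) * real c ^ 3 * real (n + \<kappa>) / real w\<rceil> \<and>
       (16 * W \<le> 2 ^ w \<longrightarrow>
         (let \<tau> = 10000 * (real c ^ 2 + real c ^ 3 * real (n + \<kappa>) / real w);
              implements = (\<lambda>\<Gamma> s. \<Gamma> \<in> vectors c n \<rightarrow> vectors (4 * c) (n + \<kappa> + 1) \<and>
                 evaluates w (16 * W) (code 0 query_com) c n (4 * c) \<tau> \<Gamma> (mem s))
          in \<exists>T. let D = run w (16 * W) (code 0 init_com) [c, n, \<kappa>] T (start (\<lambda>_. 0))
             in (\<forall>s\<in>set_pmf D. halted (code 0 init_com) s \<and> (\<exists>\<Gamma>. implements \<Gamma> s)) \<and>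
                measure_pmf.prob D {s. \<exists>\<Gamma>. implements \<Gamma> s \<and> k_unique c n (4 * c) (2 ^ \<kappa>) \<Gamma>}
                  \<ge> 1 - 1 / 2 ^ (c * n)))"
    using space_bound unfolding Let_def \<tau>_def implements_def by blast
qed

end
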